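(* For every fixed integer $r\ge 3$ and real number $s>\frac{r}{r-1}$, there are constants $C=C(r,s)$ and $d_0=d_0(r,s)$ such that the following holds for every real $d\ge d_0$. Put $\alpha_{r,s}=\frac{s}{(r-1)s-r}$. Let $H$ be an $n$-vertex $r$-graph of average degree at least $d$, where $d\le n^{1/\alpha_{r,s}}$. Then $H$ contains a nonempty subhypergraph $H'$ of average degree at least $s$ such that $$|V(H')|\le n\,d^{-\alpha_{r,s}}(\log d)^C.$$
   Context: An $r$-graph ($r$-uniform hypergraph) is a pair $H=(V(H),E(H))$ with $V(H)$ a finite set and $E(H)\subseteq\binom{V(H)}{r}$; $e(H)=|E(H)|$. An $r$-graph $F$ is a subhypergraph of $H$ if $V(F)\subseteq V(H)$ and $E(F)\subseteq E(H)$ (not necessarily induced). The average degree of an $r$-graph $H$ with nonempty vertex set is $\overline d(H)=r\,e(H)/|V(H)|$. *)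

theory Defs
  imports Complex_Main "HOL-Library.Ramsey"
begin

record 'a hypergraph =
  verts :: "'a set"
  edges :: "'a set set"

(* nsets V r, from HOL-Library.Ramsey, is the set of all r-element subsets of V. *)
definition r_graph :: "nat \<Rightarrow> 'a hypergraph \<Rightarrow> bool" where
  "r_graph r H \<longleftrightarrow> finite (verts H) \<and> edges H \<subseteq> nsets (verts H) r"

(* Not necessarily induced. That F is itself an r-graph is not implied and has to be
   required separately. *)
definition subhypergraph :: "'a hypergraph \<Rightarrow> 'a hypergraph \<Rightarrow> bool" where
  "subhypergraph F H \<longleftrightarrow> verts F \<subseteq> verts H \<and> edges F \<subseteq> edges H"

(* Meaningful only for nonempty finite vertex sets; otherwise division by zero gives 0. *)
definition avg_degree :: "nat \<Rightarrow> 'a hypergraph \<Rightarrow> real" where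
  "avg_degree r H = real r * real (card (edges H)) / real (card (verts H))"

definition alpha :: "nat \<Rightarrow> real \<Rightarrow> real" where
  "alpha r s = s / ((real r - 1) * s - real r)"

end

theory Submission
  imports Defs "HOL-Real_Asymp.Real_Asymp"
begin

text \<open>Write \<open>r / s = q + \<theta>\<close> with \<open>0 < \<theta> \<le> 1\<close>. A set \<open>F\<close> of edges is dense enough if it covers at most
  \<open>(q + \<theta>) * card F\<close> vertices. In each edge, two vertices form an edge of a multigraph, \<open>q\<close> are paid for
  by the edge itself, and the other \<open>r - 2 - q\<close> are restricted to a set of
  \<open>(r - 2 - q) * m\<close> vertices that retains as many edges as an average one, where \<open>m\<close> is
  \<open>n * d powr (- \<alpha>)\<close> up to a power of \<open>ln d\<close>. It remains to find, in a multigraph on \<open>n\<close> vertices, a small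
  set \<open>U\<close> with \<open>\<theta> * e(U) \<ge> card U + r * m\<close>.

  Suppose that there is none, and let \<open>a / b\<close> with \<open>b\<close> about \<open>ln d\<close> be slightly smaller than \<open>\<theta>\<close>. The surplus
  \<open>a * e(X) - b * card X\<close> is supermodular. A set \<open>U\<close> whose small proper supersets all have smaller
  surplus is itself small, and every vertex outside has a level \<open>Z \<ge> 0\<close>, meaning that it can be absorbed
  at cost \<open>b - Z\<close>. Passing to neighbours changes the level by \<open>a - b\<close>, and as long as the
  new level is positive the vertices reached cannot overlap much, so their number grows by almost the
  degree. Adding \<open>m\<close> free vertices to \<open>U\<close> changes the level by \<open>a\<close> and keeps about a fraction of
  degree times \<open>m / n\<close> of the vertices. Alternating both so that the level stays in \<open>{0..b}\<close>, one always
  retains at least \<open>n * (m / n) powr (Z / b)\<close> vertices and after \<open>b\<close> steps reaches level \<open>b\<close>: some vertex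
  can be absorbed for free, a contradiction.\<close>

subsection \<open>Supermodular surplus in multigraphs\<close>

text \<open>Discarding an element of least weight never lowers the average weight, so repeated
  discarding leaves \<open>m\<close> elements that are on average at least as heavy as
  \<open>V\<close>.\<close>

lemma heavy_part:
  fixes w :: "'v \<Rightarrow> real"
  assumes "finite V" "m \<le> card V"
  shows "\<exists>A\<subseteq>V. card A = m \<and> real (card V) * sum w A \<ge> real m * sum w V"
  using assms
proof (induction "card V" arbitrary: V)
  case 0
  then show ?case by auto
next
  case (Suc N)
  show ?case
  proof (cases "m = Suc N")
    case True
    then show ?thesis using Suc by (intro exI[of _ V]) auto
  next
    case False
    with Suc have mN: "m \<le> N" by auto
    have ne: "V \<noteq> {}" using Suc by auto
    obtain v where v: "v \<in> V" "\<And>u. u \<in> V \<Longrightarrow> w v \<le> w u"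
      using ex_min_if_finite[of "w ` V"] Suc ne
      by (metis (no_types, lifting) arg_min_if_finite(1) arg_min_least)
    have c: "card (V - {v}) = N" using Suc v by auto
    obtain A where A: "A \<subseteq> V - {v}" "card A = m" "real N * sum w A \<ge> real m * sum w (V - {v})"
      using Suc(1)[of "V - {v}"] Suc c mN by auto
    have sv: "sum w V = w v + sum w (V - {v})" using Suc v by (simp add: sum.remove)
    have "sum w A \<ge> real m * w v"
      using sum_bounded_below[of A "w v" w] A v by auto
    then have "real (Suc N) * sum w A \<ge> real m * sum w V"
      using A sv by (simp add: algebra_simps)
    then show ?thesis using A Suc(2) by (intro exI[of _ A]) auto
  qed
qed

text \<open>Fibre sizes serve as weights. This averaging later selects both the free vertices of a
  rooting step and the few vertices allowed in the sampled positions of hyperedges.\<close>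

lemma heavy_fibres:
  assumes "finite V" "m \<le> card V" "finite Q" "\<And>x. x \<in> Q \<Longrightarrow> f x \<in> V"
  obtains A where "A \<subseteq> V" "card A = m" "card V * card {x \<in> Q. f x \<in> A} \<ge> m * card Q"
proof -
  define w where "w v = real (card {x \<in> Q. f x = v})" for v
  have S: "sum w A = real (card {x \<in> Q. f x \<in> A})" if "A \<subseteq> V" for A
  proof -
    have fA: "finite A" using that assms finite_subset by blast
    have "card {x \<in> Q. f x \<in> A} = card (\<Union>v\<in>A. {x \<in> Q. f x = v})"
      by (rule arg_cong[of _ _ card]) auto
    also have "\<dots> = (\<Sum>v\<in>A. card {x \<in> Q. f x = v})"
      using fA assms by (intro card_UN_disjoint) auto
    finally show ?thesis by (simp add: w_def)
  qed
  obtain A where A: "A \<subseteq> V" "card A = m" "real (card V) * sum w A \<ge> real m * sum w V"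
    using heavy_part[OF assms(1,2)] by blast
  have "{x \<in> Q. f x \<in> V} = Q" using assms by auto
  then have "real (card V) * real (card {x \<in> Q. f x \<in> A}) \<ge> real m * real (card Q)"
    using A S by auto
  then have "card V * card {x \<in> Q. f x \<in> A} \<ge> m * card Q"
    by (metis of_nat_le_iff of_nat_mult)
  then show ?thesis using A that by blast
qed

locale multigraph =
  fixes V :: "'v set" and E :: "'e set" and ends :: "'e \<Rightarrow> 'v set"
  assumes finite_V: "finite V" and finite_E: "finite E"
    and ends_sub: "e \<in> E \<Longrightarrow> ends e \<subseteq> V"
    and ends_card: "e \<in> E \<Longrightarrow> card (ends e) = 2"
begin

definition inside :: "'v set \<Rightarrow> 'e set" where
  "inside X = {e \<in> E. ends e \<subseteq> X}"

definition opp :: "'v \<Rightarrow> 'e \<Rightarrow> 'v" where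
  "opp v e = the_elem (ends e - {v})"

lemma opp: "e \<in> E \<Longrightarrow> v \<in> ends e \<Longrightarrow> ends e = {v, opp v e} \<and> opp v e \<noteq> v"
proof -
  assume e: "e \<in> E" "v \<in> ends e"
  obtain x y where xy: "ends e = {x, y}" "x \<noteq> y"
    using ends_card[OF e(1)] by (auto simp: card_2_iff)
  have "ends e - {v} = {if v = x then y else x}" using xy e by auto
  then have "opp v e = (if v = x then y else x)" by (simp add: opp_def)
  then show ?thesis using xy e by auto
qed

lemma finite_inside [simp]: "finite (inside X)"
  using finite_E by (simp add: inside_def)

lemma inside_mono: "X \<subseteq> Y \<Longrightarrow> inside X \<subseteq> inside Y"
  by (auto simp: inside_def)

lemma finite_sub: "X \<subseteq> V \<Longrightarrow> finite X"
  using finite_V finite_subset by blast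

text \<open>The crossing edge \<open>e\<close> is counted by the union but by neither part; this one
  edge is the source of every later supermodularity gain.\<close>

lemma card_inside_Un_Int_cross:
  assumes "e \<in> inside (X \<union> Y)" "\<not> ends e \<subseteq> X" "\<not> ends e \<subseteq> Y"
  shows "card (inside X) + card (inside Y) + 1 \<le> card (inside (X \<union> Y)) + card (inside (X \<inter> Y))"
proof -
  have "card (inside X) + card (inside Y) = card (inside X \<union> inside Y) + card (inside (X \<inter> Y))"
    by (subst card_Un_Int) (auto simp: inside_def finite_E intro: arg_cong[of _ _ card])
  moreover have "card (insert e (inside X \<union> inside Y)) \<le> card (inside (X \<union> Y))"
    using assms by (intro card_mono) (auto simp: inside_def finite_E)
  moreover have "card (insert e (inside X \<union> inside Y)) = card (inside X \<union> inside Y) + 1"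
    using assms by (subst card_insert_disjoint) (auto simp: inside_def finite_E)
  ultimately show ?thesis by linarith
qed

text \<open>In a smallest nonempty set with at least \<delta> edges per vertex, a vertex of degree
  below \<delta> could be deleted without losing that density.\<close>

lemma min_degree_subset:
  fixes \<delta> :: real
  assumes "V' \<subseteq> V" "real (card (inside V')) \<ge> \<delta> * card V'" "\<delta> > 0" "V' \<noteq> {}"
  obtains V1 where "V1 \<subseteq> V'" "V1 \<noteq> {}" "real (card (inside V1)) \<ge> \<delta> * card V1"
    "\<And>v. v \<in> V1 \<Longrightarrow> real (card {e \<in> inside V1. v \<in> ends e}) \<ge> \<delta>"
proof -
  define P where "P X \<longleftrightarrow> X \<subseteq> V' \<and> X \<noteq> {} \<and> real (card (inside X)) \<ge> \<delta> * card X" for X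
  define V1 where "V1 = arg_min card P"
  have "P V'" using assms by (auto simp: P_def)
  then have P1: "P V1" and min: "\<And>X. P X \<Longrightarrow> card V1 \<le> card X"
    unfolding V1_def by (auto intro: arg_min_natI arg_min_nat_le)
  have fin: "finite V1" using P1 assms finite_sub by (auto simp: P_def)
  have "real (card {e \<in> inside V1. v \<in> ends e}) \<ge> \<delta>" if v: "v \<in> V1" for v
  proof (rule ccontr)
    assume neg: "\<not> ?thesis"
    have "inside V1 = inside (V1 - {v}) \<union> {e \<in> inside V1. v \<in> ends e}"
      by (auto simp: inside_def)
    then have "card (inside V1) \<le> card (inside (V1 - {v})) + card {e \<in> inside V1. v \<in> ends e}"
      by (metis card_Un_le)
    moreover have c1: "card V1 = card (V1 - {v}) + 1"
      using v fin by (metis Suc_eq_plus1 card_Suc_Diff1)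
    moreover have "real (card (inside V1)) \<ge> \<delta> * card V1" using P1 by (auto simp: P_def)
    ultimately have gt: "real (card (inside (V1 - {v}))) > \<delta> * card (V1 - {v})"
      using neg by (simp add: algebra_simps)
    have "V1 - {v} \<noteq> {}"
    proof
      assume "V1 - {v} = {}"
      moreover have "ends e \<noteq> {}" if "e \<in> E" for e using ends_card[OF that] by auto
      ultimately have "inside (V1 - {v}) = {}"
        unfolding inside_def by (metis (no_types, lifting) Collect_empty_eq subset_empty)
      then show False using gt assms(3) by (simp add: mult_less_0_iff)
    qed
    then have "P (V1 - {v})" using gt P1 by (auto simp: P_def)
    then show False using min[of "V1 - {v}"] c1 by auto
  qed
  then show ?thesis using that P1 by (auto simp: P_def)
qed

end

section \<open>Saturated sets of a multigraph\<close>

locale saturation = multigraph V E ends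
  for V :: "'v set" and E :: "'e set" and ends :: "'e \<Rightarrow> 'v set" +
  fixes a b M :: nat
  assumes a_pos: "1 \<le> a" and a_le_b: "a \<le> b"
begin

definition surplus :: "'v set \<Rightarrow> int" where
  "surplus X = int a * int (card (inside X)) - int b * int (card X)"

text \<open>Strictness makes the absorption of a vertex at zero cost a contradiction. The bound
  \<open>M\<close> restricts the comparison to small sets, the only ones that sparsity will
  control.\<close>

definition saturated :: "'v set \<Rightarrow> bool" where
  "saturated U \<longleftrightarrow> U \<subseteq> V \<and> card U \<le> M \<and>
     (\<forall>Y. U \<subset> Y \<and> Y \<subseteq> V \<and> card Y \<le> M \<longrightarrow> surplus Y < surplus U)"

lemma surplus_supermodular_cross:
  assumes "X \<subseteq> V" "Y \<subseteq> V" "e \<in> inside (X \<union> Y)" "\<not> ends e \<subseteq> X" "\<not> ends e \<subseteq> Y"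
  shows "surplus X + surplus Y + int a \<le> surplus (X \<union> Y) + surplus (X \<inter> Y)"
proof -
  have "card X + card Y = card (X \<union> Y) + card (X \<inter> Y)"
    using assms finite_sub by (intro card_Un_Int) auto
  then have 1: "int b * (int (card X) + int (card Y)) = int b * (int (card (X \<union> Y)) + int (card (X \<inter> Y)))"
    by (metis of_nat_add)
  have "int a * (int (card (inside X)) + int (card (inside Y)) + 1) \<le>
        int a * (int (card (inside (X \<union> Y))) + int (card (inside (X \<inter> Y))))"
    using card_inside_Un_Int_cross[OF assms(3-5)] by (intro mult_left_mono) auto
  with 1 show ?thesis unfolding surplus_def distrib_left by simp
qed

lemma surplus_Un_ge:
  assumes "X \<subseteq> V" "Y \<subseteq> V"
  shows "surplus (X \<union> Y) \<ge> surplus X - int b * int (card (Y - X))"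
proof -
  have fin: "finite X" "finite Y" using assms finite_sub by auto
  have "card (X \<union> Y) = card X + card (Y - X)"
    using fin card_Un_disjoint[of X "Y - X"] by (simp add: Un_Diff_cancel)
  moreover have "int a * int (card (inside X)) \<le> int a * int (card (inside (X \<union> Y)))"
    by (intro mult_left_mono) (auto intro!: card_mono inside_mono)
  ultimately show ?thesis by (simp add: surplus_def algebra_simps)
qed

lemma saturated_le:
  assumes "saturated U" "U \<subseteq> Y" "Y \<subseteq> V" "card Y \<le> M"
  shows "surplus Y \<le> surplus U"
  using assms by (cases "U = Y") (auto simp: saturated_def less_imp_le psubset_eq)

text \<open>A largest candidate is chosen, not one of maximal surplus: a proper superset of no
  smaller surplus would be a larger candidate, which yields the strict inequality.\<close>

lemma ex_saturated:
  assumes "X \<subseteq> V" "card X \<le> M"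
  obtains U where "saturated U" "X \<subseteq> U" "surplus U \<ge> surplus X"
proof -
  define C where "C = {Y. X \<subseteq> Y \<and> Y \<subseteq> V \<and> card Y \<le> M \<and> surplus Y \<ge> surplus X}"
  have "finite C" "C \<noteq> {}"
    using assms finite_V by (auto simp: C_def intro: rev_finite_subset[of "Pow V"])
  then obtain U where U: "U \<in> C" "\<And>Y. Y \<in> C \<Longrightarrow> card Y \<le> card U"
    by (metis (no_types, lifting) finite_imageI obtains_MAX Max_ge imageI)
  have "surplus Y < surplus U" if Y: "U \<subset> Y" "Y \<subseteq> V" "card Y \<le> M" for Y
  proof (rule ccontr)
    assume "\<not> ?thesis"
    then have "Y \<in> C" using U(1) Y by (auto simp: C_def)
    then have "card Y \<le> card U" using U by auto
    moreover have "card U < card Y" using Y finite_sub psubset_card_mono by blast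
    ultimately show False by simp
  qed
  then have "saturated U" using U(1) by (auto simp: saturated_def C_def)
  then show ?thesis using that U(1) by (auto simp: C_def)
qed

lemma saturated_few_edges:
  assumes "saturated U" "U \<subset> Y" "Y \<subseteq> V" "card Y \<le> M"
  shows "card {e \<in> inside Y. \<not> ends e \<subseteq> U} < b * card (Y - U)"
proof -
  have fin: "finite U" "finite Y" using assms finite_sub by auto
  have "inside Y = inside U \<union> {e \<in> inside Y. \<not> ends e \<subseteq> U}"
    using assms by (auto simp: inside_def)
  also have "card \<dots> = card (inside U) + card {e \<in> inside Y. \<not> ends e \<subseteq> U}"
    by (intro card_Un_disjoint) (auto simp: inside_def finite_E)
  finally have 1: "card (inside Y) = card (inside U) + card {e \<in> inside Y. \<not> ends e \<subseteq> U}" .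
  have 2: "card Y = card U + card (Y - U)"
    using fin assms card_Un_disjoint[of U "Y - U"] by (simp add: Un_absorb1 psubset_imp_subset)
  have "surplus Y < surplus U" using assms by (auto simp: saturated_def)
  then have "int a * int (card {e \<in> inside Y. \<not> ends e \<subseteq> U}) < int b * int (card (Y - U))"
    unfolding surplus_def 1 2 by (simp add: algebra_simps)
  then have "a * card {e \<in> inside Y. \<not> ends e \<subseteq> U} < b * card (Y - U)"
    by (metis of_nat_less_iff of_nat_mult)
  moreover have "1 * card {e \<in> inside Y. \<not> ends e \<subseteq> U} \<le> a * card {e \<in> inside Y. \<not> ends e \<subseteq> U}"
    using a_pos by (intro mult_right_mono) auto
  ultimately show ?thesis by linarith
qed

text \<open>Adding \<open>v\<close> to \<open>U\<close> by way of \<open>W\<close> costs at most \<open>b - Z\<close> of surplus. The counter \<open>k\<close> keeps the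
  witness small; \<open>Z = b\<close> contradicts saturation.\<close>

definition reach :: "'v set \<Rightarrow> nat \<Rightarrow> nat \<Rightarrow> 'v \<Rightarrow> 'v set \<Rightarrow> bool" where
  "reach U k Z v W \<longleftrightarrow> U \<subseteq> W \<and> W \<subseteq> V \<and> v \<in> W \<and> v \<notin> U \<and> card (W - U) \<le> k + 1 \<and>
     surplus W \<ge> surplus U + int Z - int b"

end

subsection \<open>Spreading and rooting\<close>

text \<open>The hypothetical counterexample: \<open>R * m\<close> is a debt that a dense set has to repay, \<open>a / b\<close> is slightly
  below \<open>\<theta>\<close>, and the excess of \<open>\<theta>\<close> over \<open>a / b\<close> pays both for the debt and for the free vertices.\<close>

locale sparse_multigraph = saturation V E ends a b "2 * (b * (R + 2 * b) * m)"
  for V :: "'v set" and E :: "'e set" and ends :: "'e \<Rightarrow> 'v set" and a b R m :: nat +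
  fixes \<theta> :: real
  assumes m_pos: "1 \<le> m" and b_ge_2: "2 \<le> b" and \<theta>_pos: "0 < \<theta>"
    and \<theta>_lower: "real a + 1 \<le> \<theta> * b" and \<theta>_upper: "\<theta> * b \<le> 2 * a"
    and sparse: "X \<subseteq> V \<Longrightarrow> card X \<le> 2 * (b * (R + 2 * b) * m) \<Longrightarrow>
      \<theta> * card (inside X) < card X + real (R * m)"
begin

abbreviation "L \<equiv> b * (R + 2 * b) * m"

text \<open>The first bound is the room needed in \<open>fibre_bound\<close>: one vertex
  \<open>w\<close> and \<open>b\<close> witnesses with at most \<open>b + 1\<close> new vertices
  each.\<close>

lemma L_ge: "b * (1 + b) + 1 \<le> L" "m \<le> L" "R * m \<le> L"
proof -
  have b: "1 \<le> b" using a_pos a_le_b by simp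
  obtain c where c: "b = c + 2" using b_ge_2 by (metis add.commute le_Suc_ex)
  have "b * (1 + b) + 1 \<le> b * (2 * b) * 1" unfolding c by (simp add: algebra_simps)
  also have "\<dots> \<le> L" using m_pos by (intro mult_le_mono) auto
  finally show "b * (1 + b) + 1 \<le> L" .
  have "1 * 1 * m \<le> L" using b by (intro mult_le_mono) auto
  then show "m \<le> L" by simp
  have "1 * R * m \<le> L" using b by (intro mult_le_mono) auto
  then show "R * m \<le> L" by simp
qed

text \<open>\<open>L\<close> is the size at which sparsity and surplus collide: the spare 1 in
  \<open>real a + 1 \<le> \<theta> * b\<close> forces
  \<open>card U < a * R * m + (a + 1) * b * m\<close>, which is at most \<open>L\<close>. The debt
  \<open>b * b * m\<close> is the most that \<open>b\<close> rooting steps accumulate.\<close>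

lemma saturated_card_less:
  assumes "saturated U" "surplus U \<ge> - int (b * b * m)"
  shows "card U < L"
proof (rule ccontr)
  assume "\<not> ?thesis"
  then have big: "real (card U) \<ge> real L" by (metis not_le of_nat_le_iff)
  have b: "real b \<ge> 1" and a: "real a \<ge> 1" using a_pos a_le_b by auto
  have "U \<subseteq> V" "card U \<le> 2 * L" using assms by (auto simp: saturated_def)
  then have s: "\<theta> * card (inside U) < card U + real (R * m)" using sparse by auto
  have "int a * int (card (inside U)) + int (b * b * m) \<ge> int b * int (card U)"
    using assms(2) by (simp add: surplus_def)
  then have "a * card (inside U) + b * b * m \<ge> b * card U"
    by (metis of_nat_add of_nat_le_iff of_nat_mult)
  then have 1: "real a * card (inside U) \<ge> b * (card U - real b * m)"
    by (simp add: algebra_simps flip: of_nat_mult of_nat_add)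
  have "b * 1 * m \<le> L" using a_pos a_le_b by (intro mult_le_mono) auto
  then have "real (b * m) \<le> real L" by (simp only: of_nat_le_iff mult_1_right)
  then have nn: "real (card U) - real b * m \<ge> 0" using big by simp
  have "(real a + 1) * (card U - real b * m) \<le> \<theta> * b * (card U - real b * m)"
    using nn \<theta>_lower by (intro mult_right_mono) auto
  also have "\<dots> = \<theta> * (b * (card U - real b * m))" by simp
  also have "\<dots> \<le> \<theta> * (real a * card (inside U))" using 1 \<theta>_pos by (intro mult_left_mono) auto
  also have "\<dots> = a * (\<theta> * card (inside U))" by simp
  also have "\<dots> < a * (card U + real (R * m))" using s a by (intro mult_strict_left_mono) auto
  finally have "card U < real a * (R * m) + (real a + 1) * (real b * m)" by (simp add: algebra_simps)
  also have "\<dots> \<le> real b * (R * m) + (real b + b) * (real b * m)"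
  proof (rule add_mono)
    show "real a * (R * m) \<le> real b * (R * m)" using a_le_b by (intro mult_right_mono) auto
    show "(real a + 1) * (real b * m) \<le> (real b + b) * (real b * m)"
      using a_le_b b by (intro mult_right_mono) auto
  qed
  also have "\<dots> = real L" by (simp add: algebra_simps)
  finally show False using big by simp
qed

text \<open>Since \<open>v\<close> lies outside \<open>U\<close>, each of these edges is new. The
  bound \<open>2 * L\<close> in the locale leaves room for \<open>L\<close> vertices on top of a
  saturated set.\<close>

lemma saturated_few_edges_at:
  assumes "saturated U" "card U < L" "U \<subseteq> Y" "Y \<subseteq> V" "card (Y - U) \<le> k" "k \<le> L" "v \<in> Y" "v \<notin> U"
  shows "card {e \<in> E. v \<in> ends e \<and> ends e \<subseteq> Y} \<le> b * k"
proof -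
  have "card {e \<in> E. v \<in> ends e \<and> ends e \<subseteq> Y} \<le> card {e \<in> inside Y. \<not> ends e \<subseteq> U}"
    using assms by (intro card_mono) (auto simp: inside_def finite_E)
  also have "\<dots> \<le> b * card (Y - U)"
  proof (rule less_imp_le, rule saturated_few_edges)
    have "card Y = card U + card (Y - U)"
      using assms finite_sub card_Un_disjoint[of U "Y - U"]
      by (metis Diff_disjoint Diff_partition finite_Diff rev_finite_subset)
    then show "card Y \<le> 2 * L" using assms by simp
  qed (use assms in auto)
  also have "\<dots> \<le> b * k" using assms by simp
  finally show ?thesis .
qed

lemma reach_card:
  assumes "reach U k Z v W" "card U < L" "k \<le> b"
  shows "card W \<le> 2 * L" "card (W - U) \<le> b + 1"
proof -
  show 1: "card (W - U) \<le> b + 1" using assms by (auto simp: reach_def)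
  have "b + 1 \<le> L" using L_ge(1) by (auto intro: order_trans[rotated])
  moreover have "card W = card U + card (W - U)"
    using assms finite_sub card_Un_disjoint[of U "W - U"] unfolding reach_def
    by (metis Diff_disjoint Diff_partition finite_Diff rev_finite_subset)
  ultimately show "card W \<le> 2 * L" using 1 assms by simp
qed

lemma no_reach_b:
  assumes "saturated U" "card U < L" "k \<le> b" "reach U k b v W"
  shows False
proof -
  have "U \<subset> W" using assms(4) by (auto simp: reach_def)
  then have "surplus W < surplus U"
    using assms reach_card[OF assms(4,2,3)] by (auto simp: saturated_def reach_def)
  then show False using assms(4) by (simp add: reach_def)
qed

text \<open>\<open>W v\<close> is a chosen witness for \<open>v\<close>. Only edges leaving it can
  cross in the sense of supermodularity. Pairs are counted so that parallel edges, and an edge used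
  from both of its ends, keep their multiplicity.\<close>

definition fwd :: "'v set \<Rightarrow> 'v set \<Rightarrow> ('v \<Rightarrow> 'v set) \<Rightarrow> ('v \<times> 'e) set" where
  "fwd V1 B W = (SIGMA v:B. {e \<in> inside V1. v \<in> ends e \<and> \<not> ends e \<subseteq> W v})"

text \<open>A witness adds at most \<open>b + 1\<close> vertices to \<open>U\<close>, so at most
  \<open>b * (b + 1)\<close> edges at \<open>v\<close> stay inside it, which is at most half of the
  minimum degree.\<close>

lemma card_fwd:
  fixes \<delta> :: real
  assumes "saturated U" "card U < L" "V1 \<subseteq> V" "B \<subseteq> V1" "k \<le> b"
    and W: "\<And>v. v \<in> B \<Longrightarrow> reach U k Z v (W v)"
    and deg: "\<And>v. v \<in> V1 \<Longrightarrow> \<delta> \<le> card {e \<in> inside V1. v \<in> ends e}"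
    and \<delta>: "\<delta> \<ge> 2 * b * (b + 1)"
  shows "real (card (fwd V1 B W)) \<ge> card B * (\<delta> / 2)"
proof -
  have fB: "finite B" using assms finite_sub by auto
  have "\<delta> / 2 \<le> card {e \<in> inside V1. v \<in> ends e \<and> \<not> ends e \<subseteq> W v}" if v: "v \<in> B" for v
  proof -
    have "{e \<in> inside V1. v \<in> ends e} \<subseteq> {e \<in> inside V1. v \<in> ends e \<and> \<not> ends e \<subseteq> W v} \<union>
        {e \<in> E. v \<in> ends e \<and> ends e \<subseteq> W v}" by (auto simp: inside_def)
    then have "card {e \<in> inside V1. v \<in> ends e} \<le> card ({e \<in> inside V1. v \<in> ends e \<and> \<not> ends e \<subseteq> W v} \<union>
        {e \<in> E. v \<in> ends e \<and> ends e \<subseteq> W v})" using finite_E by (intro card_mono) auto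
    also have "\<dots> \<le> card {e \<in> inside V1. v \<in> ends e \<and> \<not> ends e \<subseteq> W v} +
        card {e \<in> E. v \<in> ends e \<and> ends e \<subseteq> W v}" by (rule card_Un_le)
    also have "card {e \<in> E. v \<in> ends e \<and> ends e \<subseteq> W v} \<le> b * (b + 1)"
      using W[OF v] reach_card[OF W[OF v]] assms L_ge
      by (intro saturated_few_edges_at[OF assms(1,2)])
        (auto simp: reach_def intro: order_trans[OF _ L_ge(1)])
    finally have "card {e \<in> inside V1. v \<in> ends e} \<le>
        card {e \<in> inside V1. v \<in> ends e \<and> \<not> ends e \<subseteq> W v} + b * (b + 1)" by linarith
    then have "real (card {e \<in> inside V1. v \<in> ends e}) \<le>
        real (card {e \<in> inside V1. v \<in> ends e \<and> \<not> ends e \<subseteq> W v} + b * (b + 1))"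
      by (simp only: of_nat_le_iff)
    then show ?thesis using deg[of v] v assms(4) \<delta> by (auto simp: algebra_simps)
  qed
  then have "(\<Sum>v\<in>B. \<delta> / 2) \<le> (\<Sum>v\<in>B. real (card {e \<in> inside V1. v \<in> ends e \<and> \<not> ends e \<subseteq> W v}))"
    by (intro sum_mono) auto
  then show ?thesis using fB by (simp add: fwd_def)
qed

lemma fwdD:
  assumes "(v, e) \<in> fwd V1 B W" "\<And>v. v \<in> B \<Longrightarrow> reach U k Z v (W v)"
  shows "v \<in> B" "e \<in> inside V1" "e \<in> E" "ends e = {v, opp v e}" "opp v e \<noteq> v" "opp v e \<in> V1"
    "opp v e \<notin> W v" "opp v e \<notin> U"
proof -
  show v: "v \<in> B" and e: "e \<in> inside V1" "e \<in> E" using assms(1) by (auto simp: fwd_def inside_def)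
  have "v \<in> ends e" using assms(1) by (auto simp: fwd_def)
  then show 1: "ends e = {v, opp v e}" and "opp v e \<noteq> v" using opp e by blast+
  show "opp v e \<in> V1" using e 1 by (auto simp: inside_def)
  show 2: "opp v e \<notin> W v" using assms(1) 1 assms(2)[OF v] by (auto simp: fwd_def reach_def)
  then show "opp v e \<notin> U" using assms(2)[OF v] by (auto simp: reach_def)
qed

text \<open>If \<open>w\<close> had more predecessors, one could attach \<open>w\<close> (cost at most \<open>b\<close>) and then \<open>b\<close> witnesses one
  after the other, each with an edge to \<open>w\<close> that is not yet present. By supermodularity each of them
  gains \<open>Z + a - b \<ge> 1\<close>, however the witnesses overlap, and the result contradicts saturation.\<close>

lemma fibre_bound:
  assumes U: "saturated U" "card U < L" and "k \<le> b" "V1 \<subseteq> V" "w \<in> V1" "w \<notin> U" "Z + a > b"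
    and W: "\<And>v. v \<in> B \<Longrightarrow> reach U k Z v (W v)"
  shows "card {p \<in> fwd V1 B W. (case p of (v, e) \<Rightarrow> opp v e) = w} \<le> b * (1 + b * (b + 1))"
    (is "card ?X \<le> ?G")
proof (rule ccontr)
  assume neg: "\<not> ?thesis"
  have wV: "w \<in> V" using assms by auto
  have UV: "U \<subseteq> V" using U by (auto simp: saturated_def)
  have inj: "inj_on snd ?X"
  proof (rule inj_onI, clarsimp)
    fix v v' e assume *: "(v, e) \<in> fwd V1 B W" "(v', e) \<in> fwd V1 B W" "opp v' e = opp v e"
    show "v = v'"
      using fwdD(4,5)[OF *(1) W] fwdD(4,5)[OF *(2) W] *(3) by (auto simp: doubleton_eq_iff)
  qed
  have cX: "card (snd ` ?X) > ?G" using neg inj by (simp add: card_image)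
  have room: "i * (b + 1) + 1 \<le> b * (b + 1) + 1" if "i \<le> b" for i
    using that by (intro add_mono mult_right_mono) auto
  have "\<exists>Y. U \<subseteq> Y \<and> Y \<subseteq> V \<and> w \<in> Y \<and> card (Y - U) \<le> i * (b + 1) + 1 \<and>
      surplus Y \<ge> surplus U - int b + int i" if "i \<le> b" for i
    using that
  proof (induction i)
    case 0
    have "surplus (U \<union> {w}) \<ge> surplus U - int b * int (card ({w} - U))"
      using UV wV by (intro surplus_Un_ge) auto
    moreover have "{w} - U = {w}" "insert w U - U = {w}" using assms(6) by auto
    ultimately show ?case using UV wV by (intro exI[of _ "U \<union> {w}"]) auto
  next
    case (Suc i)
    then obtain Y where Y: "U \<subseteq> Y" "Y \<subseteq> V" "w \<in> Y" "card (Y - U) \<le> i * (b + 1) + 1"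
      "surplus Y \<ge> surplus U - int b + int i" by auto
    \<comment> \<open>Fewer edges at \<open>w\<close> lie inside \<open>Y\<close> than the fibre
      provides, which leaves an edge whose other end \<open>v\<close> is outside
      \<open>Y\<close>.\<close>
    have "card {e \<in> E. w \<in> ends e \<and> ends e \<subseteq> Y} \<le> b * (b * (b + 1) + 1)"
      using Y room[of i] Suc assms(6) L_ge(1)
      by (intro saturated_few_edges_at[OF U]) auto
    then have "\<not> snd ` ?X \<subseteq> {e \<in> E. w \<in> ends e \<and> ends e \<subseteq> Y}"
      using cX card_mono[of "{e \<in> E. w \<in> ends e \<and> ends e \<subseteq> Y}" "snd ` ?X"] finite_E
      by (auto simp: algebra_simps)
    then obtain p where p: "p \<in> ?X" "snd p \<notin> {e \<in> E. w \<in> ends e \<and> ends e \<subseteq> Y}" by blast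
    obtain v e where "p = (v, e)" by (cases p)
    then have ve: "(v, e) \<in> fwd V1 B W" "opp v e = w"
      and e: "\<not> (e \<in> E \<and> w \<in> ends e \<and> ends e \<subseteq> Y)" using p by auto
    note D = fwdD[OF ve(1) W, unfolded ve(2)]
    have v: "v \<notin> Y" using e D Y by auto
    note R = W[OF D(1), unfolded reach_def]
    have "surplus Y + surplus (W v) + int a \<le> surplus (Y \<union> W v) + surplus (Y \<inter> W v)"
      using Y R D v by (intro surplus_supermodular_cross[of _ _ e]) (auto simp: inside_def)
    \<comment> \<open>The overlap contains \<open>U\<close> and is small, so saturation bounds its
      surplus; this is why overlapping witnesses do no harm.\<close>
    moreover have "surplus (Y \<inter> W v) \<le> surplus U"
    proof (rule saturated_le[OF U(1)])
      have "card (Y \<inter> W v) \<le> card (W v)" using R finite_sub by (intro card_mono) auto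
      then show "card (Y \<inter> W v) \<le> 2 * L" using reach_card(1)[OF W[OF D(1)] U(2) assms(3)] by simp
    qed (use Y R in auto)
    ultimately have s: "surplus (Y \<union> W v) \<ge> surplus U - int b + int (Suc i)"
      using R Y assms(7) by auto
    have "card (Y \<union> W v - U) \<le> card (Y - U) + card (W v - U)"
      by (metis Un_Diff card_Un_le)
    also have "\<dots> \<le> Suc i * (b + 1) + 1" using Y reach_card(2)[OF W[OF D(1)] U(2) assms(3)] by simp
    finally show ?case using s Y R by (intro exI[of _ "Y \<union> W v"]) auto
  qed
  from this[of b] obtain Y where Y: "U \<subseteq> Y" "Y \<subseteq> V" "w \<in> Y" "card (Y - U) \<le> b * (b + 1) + 1"
      "surplus Y \<ge> surplus U" by auto
  have "card Y = card U + card (Y - U)"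
    using Y finite_sub card_Un_disjoint[of U "Y - U"]
    by (metis Diff_disjoint Diff_partition finite_Diff rev_finite_subset)
  then have "card Y \<le> 2 * L" using Y U L_ge(1) by simp
  moreover have "U \<subset> Y" using Y assms(6) by auto
  ultimately have "surplus Y < surplus U" using U(1) Y(2) unfolding saturated_def by blast
  then show False using Y(5) by simp
qed

text \<open>Extending the witness of \<open>v\<close> by a neighbour \<open>w\<close> costs
  \<open>b\<close> for the vertex and gains \<open>a\<close> for the edge. By
  \<open>fibre_bound\<close>, which needs the new level to be positive, each \<open>w\<close> is
  reached by boundedly many pairs.\<close>

lemma spread_step:
  assumes U: "saturated U" "card U < L" and k: "k \<le> b" and V1: "V1 \<subseteq> V" "B \<subseteq> V1"
    and Z: "Z + a > b" "Z \<le> b"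
    and W: "\<And>v. v \<in> B \<Longrightarrow> reach U k Z v (W v)"
  obtains B' where "B' \<subseteq> V1" "\<forall>w\<in>B'. \<exists>W. reach U (Suc k) (Z + a - b) w W"
    "card (fwd V1 B W) \<le> b * (1 + b * (b + 1)) * card B'"
proof -
  define f where "f = (\<lambda>(v, e). opp v e)"
  define B' where "B' = f ` fwd V1 B W"
  have fB: "finite B" using V1 finite_sub by auto
  have fQ: "finite (fwd V1 B W)" unfolding fwd_def by (intro finite_SigmaI fB) auto
  have "card (fwd V1 B W) \<le> card (\<Union>w\<in>B'. {p \<in> fwd V1 B W. f p = w})"
    using fQ by (intro card_mono) (auto simp: B'_def)
  also have "\<dots> \<le> (\<Sum>w\<in>B'. card {p \<in> fwd V1 B W. f p = w})"
    using fQ by (intro card_UN_le) (auto simp: B'_def)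
  also have "\<dots> \<le> (\<Sum>w\<in>B'. b * (1 + b * (b + 1)))"
  proof (rule sum_mono)
    fix w assume "w \<in> B'"
    then obtain v e where "(v, e) \<in> fwd V1 B W" "w = opp v e" by (auto simp: B'_def f_def)
    then have "w \<in> V1" "w \<notin> U" using fwdD[OF _ W] by auto
    then show "card {p \<in> fwd V1 B W. f p = w} \<le> b * (1 + b * (b + 1))"
      unfolding f_def using U k V1 Z W by (intro fibre_bound) auto
  qed
  finally have 1: "card (fwd V1 B W) \<le> b * (1 + b * (b + 1)) * card B'" by (simp add: mult.commute)
  have 2: "\<exists>W'. reach U (Suc k) (Z + a - b) w W'" if "w \<in> B'" for w
  proof -
    obtain v e where ve: "(v, e) \<in> fwd V1 B W" "w = opp v e" using \<open>w \<in> B'\<close> by (auto simp: B'_def f_def)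
    note D = fwdD[OF ve(1) W]
    note R = W[OF D(1), unfolded reach_def]
    have wV: "w \<in> V" using D(6) ve V1 by auto
    have UV: "U \<subseteq> V" using U by (auto simp: saturated_def)
    have fW: "finite (W v)" using R finite_sub by auto
    have "surplus (W v) + surplus (U \<union> {w}) + int a \<le>
        surplus (W v \<union> (U \<union> {w})) + surplus (W v \<inter> (U \<union> {w}))"
      using R D wV UV ve by (intro surplus_supermodular_cross[of _ _ e]) (auto simp: inside_def)
    moreover have "W v \<inter> (U \<union> {w}) = U" "W v \<union> (U \<union> {w}) = insert w (W v)" "{w} - U = {w}"
      using R D ve by auto
    moreover have "surplus (U \<union> {w}) \<ge> surplus U - int b * int (card ({w} - U))"
      using UV wV by (intro surplus_Un_ge) auto
    moreover have "int (Z + a - b) = int Z + int a - int b" using Z by (simp add: of_nat_diff)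
    moreover have "surplus (W v) \<ge> surplus U + int Z - int b" using R by blast
    ultimately have "surplus (insert w (W v)) \<ge> surplus U + int (Z + a - b) - int b"
      by simp
    moreover have "card (insert w (W v) - U) \<le> Suc k + 1"
      using R fW card_insert_le_m1 D ve by (auto simp: insert_Diff_if card_insert_if)
    ultimately show ?thesis using R wV D ve unfolding reach_def
      by (intro exI[of _ "insert w (W v)"]) auto
  qed
  have "B' \<subseteq> V1" using fwdD(6)[OF _ W] by (auto simp: B'_def f_def)
  then show ?thesis using that 1 2 by blast
qed

text \<open>Adding \<open>m\<close> free vertices \<open>A\<close> lowers the surplus of the saturated set by at most \<open>b * m\<close>, but raises by
  \<open>a\<close> the level of every vertex with a neighbour in \<open>A\<close> that stays outside of the new saturated set.\<close>

lemma root_step: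
  assumes U: "saturated U" "card U < L" "surplus U \<ge> - int (b * k * m)"
    and k: "k < b" and V1: "V1 \<subseteq> V" "B \<subseteq> V1" "m \<le> card V1"
    and Z: "Z + a \<le> b"
    and W: "\<And>v. v \<in> B \<Longrightarrow> reach U k Z v (W v)"
  obtains B' U' where "saturated U'" "surplus U' \<ge> - int (b * Suc k * m)" "B' \<subseteq> V1"
    "\<forall>w\<in>B'. \<exists>W. reach U' (Suc k) (Z + a) w W"
    "m * card (fwd V1 B W) \<le> card V1 * (2 * card (inside U') + b * card B')"
proof -
  define f where "f = (\<lambda>(v, e). opp v e)"
  have fB: "finite B" using V1 finite_sub by auto
  have UV: "U \<subseteq> V" using U by (auto simp: saturated_def)
  have fQ: "finite (fwd V1 B W)" unfolding fwd_def by (intro finite_SigmaI fB) auto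
  obtain A where A: "A \<subseteq> V1" "card A = m"
    "m * card (fwd V1 B W) \<le> card V1 * card {p \<in> fwd V1 B W. f p \<in> A}"
  proof (rule heavy_fibres[of V1 m "fwd V1 B W" f])
    show "f p \<in> V1" if "p \<in> fwd V1 B W" for p
      using fwdD(6)[OF _ W] that unfolding f_def by (cases p) auto
  qed (use V1 fQ finite_sub in auto)
  define Q where "Q = {p \<in> fwd V1 B W. f p \<in> A}"
  have fA: "finite A" using A V1 finite_sub by auto
  have "card (U \<union> A) \<le> 2 * L" using card_Un_le[of U A] U(2) A(2) L_ge(2) by linarith
  then obtain U' where U': "saturated U'" "U \<union> A \<subseteq> U'" "surplus U' \<ge> surplus (U \<union> A)"
    using ex_saturated[of "U \<union> A"] UV A(1) V1(1) by blast
  have "surplus (U \<union> A) \<ge> surplus U - int b * int (card (A - U))"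
    using UV A V1 by (intro surplus_Un_ge) auto
  moreover have "int b * int (card (A - U)) \<le> int b * int m"
    using A fA by (intro mult_left_mono) (auto intro!: card_mono)
  ultimately have sU': "surplus U' \<ge> - int (b * Suc k * m)"
    using U' U(3) by (simp add: algebra_simps)
  \<comment> \<open>As \<open>k < b\<close>, the accumulated debt still falls within
    \<open>saturated_card_less\<close>.\<close>
  have "b * Suc k * m \<le> b * b * m" using k by (intro mult_le_mono) auto
  then have "surplus U' \<ge> - int (b * b * m)" using sU' by linarith
  then have cU': "card U' < L" using U' saturated_card_less by auto
  have UV': "U' \<subseteq> V" using U' by (auto simp: saturated_def)
  define B' where "B' = {v \<in> B - U'. \<exists>e. (v, e) \<in> Q}"
  have QD: "v \<in> B" "e \<in> E" "ends e = {v, opp v e}" "opp v e \<in> U'" "opp v e \<notin> U" "opp v e \<notin> W v"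
    if "(v, e) \<in> Q" for v e
    using that fwdD[OF _ W] U' by (auto simp: Q_def f_def)
  \<comment> \<open>\<open>Q1\<close> covers the pairs whose start was absorbed by
    \<open>U'\<close>, at most two for each edge inside \<open>U'\<close>; \<open>Q2\<close> covers
    those whose start stays outside, at most \<open>b\<close> for each vertex.\<close>
  define Q1 where "Q1 = (\<lambda>(e, v). (v, e)) ` (SIGMA e:inside U'. ends e)"
  define Q2 where "Q2 = (SIGMA v:B'. {e \<in> E. v \<in> ends e \<and> ends e \<subseteq> insert v U'})"
  have fe: "finite (ends e)" if "e \<in> E" for e using ends_card[OF that] card.infinite by fastforce
  have fB': "finite B'" using fB by (auto simp: B'_def)
  have "Q \<subseteq> Q1 \<union> Q2"
  proof
    fix p assume p: "p \<in> Q"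
    obtain v e where ve: "p = (v, e)" by (cases p)
    note D = QD[OF p[unfolded ve]]
    show "p \<in> Q1 \<union> Q2"
    proof (cases "v \<in> U'")
      case True
      then have "(e, v) \<in> (SIGMA e:inside U'. ends e)" using D by (auto simp: inside_def)
      then show ?thesis unfolding ve Q1_def by force
    next
      case False
      then show ?thesis using D p ve by (auto simp: Q2_def B'_def)
    qed
  qed
  moreover have f1: "finite (SIGMA e:inside U'. ends e)" by (auto simp: inside_def fe finite_E)
  moreover have f2: "finite Q2" using fB' finite_E by (auto simp: Q2_def)
  ultimately have "card Q \<le> card (Q1 \<union> Q2)" unfolding Q1_def by (intro card_mono) auto
  also have "\<dots> \<le> card Q1 + card Q2" by (rule card_Un_le)
  also have "card Q1 \<le> card (SIGMA e:inside U'. ends e)" unfolding Q1_def by (rule card_image_le[OF f1])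
  also have "card (SIGMA e:inside U'. ends e) = (\<Sum>e\<in>inside U'. card (ends e))"
    by (intro card_SigmaI) (auto simp: inside_def fe finite_E)
  also have "\<dots> = (\<Sum>e\<in>inside U'. 2)" by (intro sum.cong) (auto simp: inside_def ends_card)
  also have "card Q2 = (\<Sum>v\<in>B'. card {e \<in> E. v \<in> ends e \<and> ends e \<subseteq> insert v U'})"
    unfolding Q2_def using fB' finite_E by (intro card_SigmaI) auto
  also have "\<dots> \<le> (\<Sum>v\<in>B'. b * 1)"
  proof (rule sum_mono)
    fix v assume v: "v \<in> B'"
    then have "v \<notin> U'" "v \<in> V" using V1 by (auto simp: B'_def)
    moreover have "insert v U' - U' \<subseteq> {v}" by auto
    then have "card (insert v U' - U') \<le> 1" by (metis card.empty card_insert_le_m1 card_mono finite.emptyI finite_insert is_singletonI is_singleton_altdef)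
    ultimately show "card {e \<in> E. v \<in> ends e \<and> ends e \<subseteq> insert v U'} \<le> b * 1"
      using UV' L_ge(2) m_pos
      by (intro saturated_few_edges_at[OF U'(1) cU'] order_trans[OF m_pos L_ge(2)]) auto
  qed
  finally have cQ: "card Q \<le> 2 * card (inside U') + b * card B'" by (simp add: mult.commute)
  have "card V1 * card Q \<le> card V1 * (2 * card (inside U') + b * card B')"
    using cQ by (rule mult_le_mono2)
  then have 1: "m * card (fwd V1 B W) \<le> card V1 * (2 * card (inside U') + b * card B')"
    using A(3) unfolding Q_def by linarith
  have 2: "\<exists>W. reach U' (Suc k) (Z + a) v W" if vB': "v \<in> B'" for v
  proof -
    obtain e where v: "v \<in> B" "v \<notin> U'" and ve: "(v, e) \<in> Q" using vB' by (auto simp: B'_def)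
    note D = QD[OF ve]
    note R = W[OF D(1), unfolded reach_def]
    have kb: "k \<le> b" using k by simp
    \<comment> \<open>The edge crosses because its other end \<open>opp v e\<close> already belongs
      to \<open>U'\<close>; hence the full gain of \<open>a\<close> with no vertex to pay
      for.\<close>
    have "surplus U' + surplus (W v) + int a \<le> surplus (U' \<union> W v) + surplus (U' \<inter> W v)"
      using R D v UV' by (intro surplus_supermodular_cross[of _ _ e]) (auto simp: inside_def)
    moreover have "surplus (U' \<inter> W v) \<le> surplus U"
    proof (rule saturated_le[OF U(1)])
      have "card (U' \<inter> W v) \<le> card (W v)" using R finite_sub by (intro card_mono) auto
      then show "card (U' \<inter> W v) \<le> 2 * L" using reach_card(1)[OF W[OF D(1)] U(2) kb] by simp
    qed (use R U' in auto)
    ultimately have "surplus (U' \<union> W v) \<ge> surplus U' + int (Z + a) - int b" using R by auto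
    moreover have "card (U' \<union> W v - U') \<le> card (W v - U)"
      using R U' finite_sub by (intro card_mono) auto
    ultimately show ?thesis using R UV' v unfolding reach_def by (intro exI[of _ "U' \<union> W v"]) auto
  qed
  have "B' \<subseteq> V1" using V1 by (auto simp: B'_def)
  then show ?thesis using that[OF U'(1) sU'] 1 2 by blast
qed

end

section \<open>Counting the surviving vertices over \<open>b\<close> steps\<close>

context sparse_multigraph
begin

text \<open>With \<open>x = m / card V1\<close>, the guaranteed number of survivors is multiplied by
  \<open>x powr (a / b - 1)\<close> in a spreading step and by \<open>x powr (a / b)\<close> in a
  rooting step. \<Gamma> absorbs all other factors, and the 2 in \<open>many_edges\<close> pays for
  deleting a first saturated set.\<close>

context
  fixes n :: nat and \<delta> \<Gamma> :: real
  assumes card_V: "card V \<le> n" and L_le: "L \<le> n"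
    and \<Gamma>: "\<Gamma> = (10 + 8 * (real R + 2) / \<theta>) * b ^ 3"
    and \<delta>: "\<delta> \<ge> \<Gamma> * (n / m) powr (1 - a / b)"
    and many_edges: "card E \<ge> 2 * n * \<delta>"
begin

lemma \<Gamma>_ge: "\<Gamma> \<ge> 10 * real b ^ 3"
  "\<Gamma> \<ge> 8 * (real R + 2) * real b ^ 3 / \<theta> + 10 * real b ^ 3" "\<delta> \<ge> \<Gamma>" "\<Gamma> \<ge> 0"
proof -
  show 1: "\<Gamma> \<ge> 8 * (real R + 2) * real b ^ 3 / \<theta> + 10 * real b ^ 3" unfolding \<Gamma> by (simp add: algebra_simps)
  have "8 * (real R + 2) * real b ^ 3 / \<theta> \<ge> 0" using \<theta>_pos by simp
  then show 2: "\<Gamma> \<ge> 10 * real b ^ 3" using 1 by linarith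
  have "m \<le> n" using L_ge(2) L_le by (rule order_trans)
  then have "real n / m \<ge> 1" using m_pos by simp
  then have "(n / m) powr (1 - a / b) \<ge> 1" using a_le_b b_ge_2 by (intro ge_one_powr_ge_zero) auto
  moreover show 3: "\<Gamma> \<ge> 0" using 2 by (auto intro: order_trans[rotated])
  ultimately have "\<Gamma> * 1 \<le> \<Gamma> * (n / m) powr (1 - a / b)" by (intro mult_left_mono) auto
  then show "\<delta> \<ge> \<Gamma>" using \<delta> by simp
qed

lemma b_powers: "real b \<ge> 2" "real b ^ 2 \<ge> real b" "real b ^ 3 \<ge> real b ^ 2" "real b ^ 3 \<ge> 0"
proof -
  show 1: "real b \<ge> 2" using b_ge_2 by simp
  show "real b ^ 2 \<ge> real b" using 1 by (simp add: power2_eq_square)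
  show "real b ^ 3 \<ge> real b ^ 2" using 1 by (intro power_increasing) auto
  show "real b ^ 3 \<ge> 0" by simp
qed

lemma card_inside_saturated:
  assumes "saturated U" "card U < L"
  shows "card (inside U) \<le> 2 * real L / \<theta>"
proof -
  have "\<theta> * card (inside U) < card U + real (R * m)"
    using assms by (intro sparse) (auto simp: saturated_def)
  also have "\<dots> \<le> real L + real L"
    using assms(2) L_ge(3) by (intro add_mono) (auto simp only: of_nat_le_iff less_imp_le)
  finally show ?thesis using \<theta>_pos by (simp add: field_simps)
qed

text \<open>Removing a saturated set grown from the empty one loses at most
  \<open>n * \<delta>\<close> edges: few lie inside it, and each outside vertex sends at most
  \<open>b\<close> into it. The rest contains a core of minimum degree \<delta>; if the core had at
  most \<open>L\<close> vertices, adding it to the saturated set would violate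
  \<open>saturated_few_edges\<close>.\<close>

lemma ex_core:
  obtains U0 V1 where "saturated U0" "surplus U0 \<ge> 0" "V1 \<subseteq> V - U0" "card V1 > L"
    "\<forall>v\<in>V1. \<delta> \<le> card {e \<in> inside V1. v \<in> ends e}"
proof -
  obtain U where U: "saturated U" "surplus U \<ge> surplus {}"
    using ex_saturated[of "{}"] by auto
  moreover have "surplus {} \<ge> 0" by (simp add: surplus_def)
  ultimately have sU: "surplus U \<ge> 0" by linarith
  then have cU: "card U < L" using U(1) by (intro saturated_card_less) (auto intro: order_trans[rotated])
  have UV: "U \<subseteq> V" using U by (auto simp: saturated_def)
  define V' where "V' = V - U"
  have fV': "finite V'" using finite_V by (simp add: V'_def)
  have "E \<subseteq> inside V' \<union> inside U \<union> (\<Union>v\<in>V'. {e \<in> E. v \<in> ends e \<and> ends e \<subseteq> insert v U})"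
  proof
    fix e assume e: "e \<in> E"
    obtain x y where xy: "ends e = {x, y}" using ends_card[OF e] by (auto simp: card_2_iff)
    then have "x \<in> V" "y \<in> V" using ends_sub[OF e] by auto
    then show "e \<in> inside V' \<union> inside U \<union> (\<Union>v\<in>V'. {e \<in> E. v \<in> ends e \<and> ends e \<subseteq> insert v U})"
      using e xy by (auto simp: inside_def V'_def)
  qed
  then have "card E \<le> card (inside V' \<union> inside U \<union> (\<Union>v\<in>V'. {e \<in> E. v \<in> ends e \<and> ends e \<subseteq> insert v U}))"
    using fV' finite_E by (intro card_mono) auto
  also have "\<dots> \<le> card (inside V') + card (inside U) +
      card (\<Union>v\<in>V'. {e \<in> E. v \<in> ends e \<and> ends e \<subseteq> insert v U})"
    by (meson add_mono card_Un_le le_refl order_trans)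
  also have "card (\<Union>v\<in>V'. {e \<in> E. v \<in> ends e \<and> ends e \<subseteq> insert v U}) \<le> (\<Sum>v\<in>V'. b * 1)"
  proof (rule order_trans[OF card_UN_le[OF fV']], rule sum_mono)
    fix v assume v: "v \<in> V'"
    have "insert v U - U = {v}" using v by (auto simp: V'_def)
    then show "card {e \<in> E. v \<in> ends e \<and> ends e \<subseteq> insert v U} \<le> b * 1"
      using v UV L_ge by (intro saturated_few_edges_at[OF U(1) cU] order_trans[OF m_pos L_ge(2)]) (auto simp: V'_def)
  qed
  also have "(\<Sum>v\<in>V'. b * 1) \<le> n * b"
    using card_V card_mono[of V V'] finite_V by (auto simp: V'_def intro: order_trans)
  finally have "real (card E) \<le> real (card (inside V') + card (inside U) + n * b)"
    by (simp only: of_nat_le_iff)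
  moreover have "card (inside U) \<le> n * (2 / \<theta>)"
  proof -
    have "2 * real L / \<theta> \<le> 2 * real n / \<theta>"
      using L_le \<theta>_pos by (intro divide_right_mono mult_left_mono) (auto simp only: of_nat_le_iff less_imp_le)
    then have "card (inside U) \<le> 2 * real n / \<theta>"
      using card_inside_saturated[OF U(1) cU] by (rule order_trans[rotated])
    then show ?thesis by (simp add: mult.commute)
  qed
  moreover have "n * (2 / \<theta>) + n * real b \<le> n * \<delta>"
  proof -
    have "2 * 1 * 1 \<le> 8 * (real R + 2) * real b ^ 3"
      using b_powers by (intro mult_mono) auto
    then have "2 / \<theta> \<le> 8 * (real R + 2) * real b ^ 3 / \<theta>"
      using \<theta>_pos by (intro divide_right_mono) auto
    then have "2 / \<theta> + b \<le> \<delta>" using \<Gamma>_ge(2,3) b_powers by linarith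
    then have "n * (2 / \<theta> + b) \<le> n * \<delta>" by (intro mult_left_mono) auto
    then show ?thesis by (simp add: distrib_left)
  qed
  ultimately have in': "card (inside V') \<ge> n * \<delta>" using many_edges by simp
  have \<delta>_pos: "\<delta> > 0" and \<delta>_b: "\<delta> \<ge> b" using \<Gamma>_ge(1,3) b_powers by linarith+
  have n_pos: "n > 0" using L_le L_ge by simp
  have "V' \<noteq> {}"
  proof
    assume V': "V' = {}"
    have "ends e \<noteq> {}" if "e \<in> E" for e using ends_card[OF that] by auto
    then have "inside V' = {}"
      unfolding inside_def V' by (metis (no_types, lifting) Collect_empty_eq subset_empty)
    then show False using in' \<delta>_pos n_pos by (simp add: mult_le_0_iff)
  qed
  moreover have "\<delta> * card V' \<le> n * \<delta>"
    using card_V card_mono[of V V'] finite_V \<delta>_pos by (auto simp: V'_def)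
  ultimately have "V' \<noteq> {}" "\<delta> * card V' \<le> card (inside V')" "V' \<subseteq> V"
    using in' by (auto simp: V'_def)
  then obtain V1 where V1: "V1 \<subseteq> V'" "V1 \<noteq> {}" "real (card (inside V1)) \<ge> \<delta> * card V1"
    "\<And>v. v \<in> V1 \<Longrightarrow> real (card {e \<in> inside V1. v \<in> ends e}) \<ge> \<delta>"
    using min_degree_subset[of V' \<delta>] \<delta>_pos by blast
  have fin: "finite V1" "finite U" using finite_subset[OF V1(1) fV'] finite_sub[OF UV] by auto
  have dis: "U \<inter> V1 = {}" using V1 by (auto simp: V'_def)
  have "card V1 > L"
  proof (rule ccontr)
    assume neg: "\<not> card V1 > L"
    have "card {e \<in> inside (U \<union> V1). \<not> ends e \<subseteq> U} < b * card (U \<union> V1 - U)"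
      using neg cU fin dis V1 UV by (intro saturated_few_edges[OF U(1)]) (auto simp: V'_def card_Un_disjoint)
    moreover have "U \<union> V1 - U = V1" using dis by auto
    moreover have "card (inside V1) \<le> card {e \<in> inside (U \<union> V1). \<not> ends e \<subseteq> U}"
    proof (intro card_mono subsetI)
      fix e assume e: "e \<in> inside V1"
      then have "ends e \<noteq> {}" using ends_card[of e] by (auto simp: inside_def)
      then show "e \<in> {e \<in> inside (U \<union> V1). \<not> ends e \<subseteq> U}"
        using e dis by (auto simp: inside_def)
    qed auto
    ultimately have "card (inside V1) < b * card V1" by simp
    then have "real (card (inside V1)) < real (b * card V1)" by (simp only: of_nat_less_iff)
    also have "\<dots> \<le> \<delta> * card V1" using \<delta>_b by (simp add: mult_right_mono)
    finally show False using V1 by simp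
  qed
  then show ?thesis using that[OF U(1) sU, of V1] V1 by (auto simp: V'_def)
qed

text \<open>The overlap factor is at most \<open>3 * b ^ 3\<close>, which half of \<Gamma> covers,
  so the pure power of \<open>x\<close> remains as growth.\<close>

lemma spread_bound:
  fixes n1 x t :: real
  assumes "x > 0" "n1 \<ge> 0" and \<delta>x: "\<delta> \<ge> \<Gamma> * x powr (- (1 - a / b))"
    and B: "real cB \<ge> n1 * x powr t" and Q: "real cQ \<ge> cB * (\<delta> / 2)"
    and Q': "cQ \<le> b * (1 + b * (b + 1)) * cB'"
  shows "real cB' \<ge> n1 * x powr (t - (1 - a / b))"
proof -
  define y where "y = x powr (- (1 - a / b))"
  have y: "y \<ge> 0" by (simp add: y_def)
  have "6 * real b ^ 3 * y \<le> \<Gamma> * y" using \<Gamma>_ge(1) b_powers(4) y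
    by (intro mult_right_mono) linarith+
  then have "\<delta> / 2 \<ge> 3 * real b ^ 3 * y" using \<delta>x by (simp add: y_def)
  then have "n1 * x powr t * (3 * real b ^ 3 * y) \<le> cB * (\<delta> / 2)"
    using B y assms(1,2) by (intro mult_mono) auto
  also have "\<dots> \<le> real (b * (1 + b * (b + 1)) * cB')"
    using Q Q' by (meson of_nat_mono order_trans)
  also have "\<dots> \<le> 3 * real b ^ 3 * cB'"
  proof -
    have "real (b * (1 + b * (b + 1))) = real b + real b ^ 2 + real b ^ 3"
      by (simp add: algebra_simps power2_eq_square power3_eq_cube)
    then have "real (b * (1 + b * (b + 1))) \<le> 3 * real b ^ 3" using b_powers by linarith
    then show ?thesis unfolding of_nat_mult[of "b * (1 + b * (b + 1))"] by (intro mult_right_mono) auto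
  qed
  finally have "(3 * real b ^ 3) * (n1 * x powr t * y) \<le> (3 * real b ^ 3) * cB'" by (simp add: mult_ac)
  then have "n1 * x powr t * y \<le> cB'" using b_powers by (subst (asm) mult_le_cancel_left_pos) auto
  then show ?thesis by (simp add: y_def powr_diff powr_minus divide_inverse mult_ac)
qed

text \<open>Of the two summands of \<open>\<Gamma> / 2\<close>, the one with \<theta> pays for the
  pairs absorbed into the new saturated set and the other for the factor \<open>b\<close>. As the
  new level is at most \<open>b\<close>, the target is at least \<open>m\<close> and thus comparable
  with \<open>L\<close>, a multiple of \<open>m\<close>.\<close>

lemma root_bound:
  fixes n1 :: nat and x t :: real
  assumes n1: "n1 > 0" "m \<le> n1" and x: "x = m / n1" and \<delta>x: "\<delta> \<ge> \<Gamma> * x powr (- (1 - a / b))"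
    and t: "t + a / b \<le> 1"
    and B: "real cB \<ge> n1 * x powr t" and Q: "real cQ \<ge> cB * (\<delta> / 2)"
    and I: "real cI \<le> 2 * real L / \<theta>"
    and Q': "m * cQ \<le> n1 * (2 * cI + b * cB')"
  shows "real cB' \<ge> n1 * x powr (t + a / b)"
proof -
  have x01: "x > 0" "x \<le> 1" using n1 m_pos by (auto simp: x)
  define Y where "Y = n1 * x powr (t + a / b)"
  have Y: "Y \<ge> m"
  proof -
    have "x powr 1 \<le> x powr (t + a / b)" using x01 t by (intro powr_mono') auto
    then have "n1 * x powr 1 \<le> Y" unfolding Y_def by (intro mult_left_mono) auto
    moreover have "n1 * x powr 1 = m" using n1 x01 by (simp add: x)
    ultimately show ?thesis by simp
  qed
  have xp: "x * (x powr t * x powr (- (1 - a / b))) = x powr (t + a / b)"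
    using x01 by (simp add: powr_add powr_minus powr_diff field_simps)
  have "n1 * x powr t * (\<Gamma> * x powr (- (1 - a / b)) / 2) \<le> cB * (\<delta> / 2)"
    using B \<delta>x \<Gamma>_ge(4) by (intro mult_mono divide_right_mono mult_nonneg_nonneg divide_nonneg_pos) auto
  also have "\<dots> \<le> cQ" by (rule Q)
  finally have "x * (n1 * x powr t * (\<Gamma> * x powr (- (1 - a / b)) / 2)) \<le> x * cQ"
    using x01 by (intro mult_left_mono) auto
  moreover have "x * (n1 * x powr t * (\<Gamma> * x powr (- (1 - a / b)) / 2)) =
      n1 * (x * (x powr t * x powr (- (1 - a / b)))) * (\<Gamma> / 2)" by (simp add: algebra_simps)
  ultimately have 1: "Y * (\<Gamma> / 2) \<le> x * cQ" by (simp only: xp Y_def)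
  define D where "D = (real R + 2) * real b ^ 3 * Y / \<theta>"
  have "real (m * cQ) \<le> real (n1 * (2 * cI + b * cB'))" using Q' by (simp only: of_nat_le_iff)
  then have 2: "x * cQ \<le> 2 * real cI + b * real cB'" using n1 by (simp add: x field_simps)
  have "real L \<le> (real R + 2) * b ^ 2 * Y"
  proof -
    have "real L = (real b * R + 2 * b ^ 2) * m" by (simp add: algebra_simps power2_eq_square)
    also have "\<dots> \<le> (real b ^ 2 * R + 2 * b ^ 2) * Y"
      using Y b_powers by (intro mult_mono add_mono mult_right_mono) auto
    finally show ?thesis by (simp add: algebra_simps)
  qed
  also have "\<dots> \<le> (real R + 2) * b ^ 3 * Y"
    using b_powers Y by (intro mult_right_mono mult_left_mono) auto
  finally have "real L / \<theta> \<le> (real R + 2) * b ^ 3 * Y / \<theta>"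
    using \<theta>_pos by (intro divide_right_mono) auto
  then have "2 * (2 * real L / \<theta>) \<le> 4 * D" by (simp add: D_def)
  then have "2 * real cI \<le> 4 * D" using I by linarith
  moreover have "Y * (4 * (real R + 2) * real b ^ 3 / \<theta> + 5 * real b ^ 3) \<le> Y * (\<Gamma> / 2)"
  proof (rule mult_left_mono)
    have "2 * (4 * (real R + 2) * real b ^ 3 / \<theta> + 5 * real b ^ 3) =
        8 * (real R + 2) * real b ^ 3 / \<theta> + 10 * real b ^ 3" by (simp add: field_simps)
    then show "4 * (real R + 2) * real b ^ 3 / \<theta> + 5 * real b ^ 3 \<le> \<Gamma> / 2"
      using \<Gamma>_ge(2) by linarith
  qed (use Y in linarith)
  moreover have "Y * (4 * (real R + 2) * real b ^ 3 / \<theta> + 5 * real b ^ 3) = 4 * D + Y * (5 * b ^ 3)"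
    by (simp add: D_def field_simps)
  ultimately have "Y * (5 * b ^ 3) \<le> b * real cB'" using 1 2 by linarith
  moreover have "Y * b \<le> Y * (5 * b ^ 3)"
  proof (rule mult_left_mono)
    have "real b \<le> 5 * real b ^ 3" using b_powers by linarith
    then show "real b \<le> real (5 * b ^ 3)" by simp
  qed (use Y in linarith)
  ultimately have "b * Y \<le> b * real cB'" by (simp add: mult.commute)
  then show ?thesis using b_powers unfolding Y_def by (subst (asm) mult_le_cancel_left_pos) auto
qed

text \<open>The bound on \<open>B\<close> depends only on the level: all of \<open>V1\<close> at
  level 0, \<open>m\<close> vertices at level \<open>b\<close>. The order in which steps were made
  is not recorded. The permitted debt is that of \<open>k\<close> rootings.\<close>

definition stage :: "'v set \<Rightarrow> nat \<Rightarrow> nat \<Rightarrow> bool" where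
  "stage V1 k Z \<longleftrightarrow> (\<exists>U B W. saturated U \<and> surplus U \<ge> - int (b * k * m) \<and> B \<subseteq> V1 \<and>
     (\<forall>v\<in>B. reach U k Z v (W v)) \<and> real (card B) \<ge> card V1 * (m / card V1) powr (Z / b))"

lemma stageE:
  assumes "stage V1 k Z" "k \<le> b"
  obtains U B W where "saturated U" "surplus U \<ge> - int (b * k * m)" "card U < L" "B \<subseteq> V1"
    "\<forall>v\<in>B. reach U k Z v (W v)" "real (card B) \<ge> card V1 * (m / card V1) powr (Z / b)"
proof -
  obtain U B W where *: "saturated U" "surplus U \<ge> - int (b * k * m)" "B \<subseteq> V1"
    "\<forall>v\<in>B. reach U k Z v (W v)" "real (card B) \<ge> card V1 * (m / card V1) powr (Z / b)"
    using assms(1) unfolding stage_def by blast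
  have "b * k * m \<le> b * b * m" using assms(2) by (intro mult_le_mono) auto
  then have "card U < L" using *(2) by (intro saturated_card_less[OF *(1)]) linarith
  then show ?thesis using that[OF *(1,2) _ *(3-5)] by blast
qed

lemma stageI:
  assumes "saturated U" "surplus U \<ge> - int (b * k * m)" "B \<subseteq> V1"
    "\<And>v. v \<in> B \<Longrightarrow> \<exists>W. reach U k Z v W" "real (card B) \<ge> card V1 * (m / card V1) powr (Z / b)"
  shows "stage V1 k Z"
proof -
  have "\<forall>v\<in>B. reach U k Z v (SOME W. reach U k Z v W)" using assms(4) by (auto intro: someI_ex)
  then show ?thesis unfolding stage_def using assms(1-3,5)
    by (intro exI[of _ U] exI[of _ B] exI[of _ "\<lambda>v. SOME W. reach U k Z v W"]) blast
qed

lemma not_stage_b: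
  assumes "k \<le> b" "V1 \<noteq> {}" "V1 \<subseteq> V"
  shows "\<not> stage V1 k b"
proof
  assume "stage V1 k b"
  then obtain U B W where *: "saturated U" "card U < L" "\<forall>v\<in>B. reach U k b v (W v)"
    "real (card B) \<ge> card V1 * (m / card V1) powr (b / b)"
    using assms(1) by (rule stageE)
  have "card V1 > 0" using assms finite_sub by (auto simp: card_gt_0_iff)
  then have "card V1 * (m / card V1) powr (b / b) > 0" using m_pos by simp
  then have "B \<noteq> {}" using *(4) by auto
  then show False using no_reach_b[OF *(1,2) assms(1)] *(3) by blast
qed

lemma stage_0:
  assumes "saturated U0" "surplus U0 \<ge> 0" "V1 \<subseteq> V - U0" "V1 \<noteq> {}"
  shows "stage V1 0 0"
proof (rule stageI[OF assms(1) _ order_refl])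
  have UV: "U0 \<subseteq> V" using assms by (auto simp: saturated_def)
  show "\<exists>W. reach U0 0 0 v W" if "v \<in> V1" for v
  proof -
    have "surplus (U0 \<union> {v}) \<ge> surplus U0 - int b * int (card ({v} - U0))"
      using assms(3) that UV by (intro surplus_Un_ge) auto
    moreover have "{v} - U0 = {v}" "insert v U0 - U0 = {v}" using assms(3) that by auto
    ultimately show ?thesis using assms(3) that UV by (auto simp: reach_def intro!: exI[of _ "insert v U0"])
  qed
qed (use assms(2) m_pos in auto)

context
  fixes V1 :: "'v set"
  assumes V1: "V1 \<subseteq> V" "L < card V1"
    and deg: "\<And>v. v \<in> V1 \<Longrightarrow> \<delta> \<le> card {e \<in> inside V1. v \<in> ends e}"
begin

lemma V1_facts:
  shows "card V1 > 0" "m \<le> card V1" "0 < m / card V1" "\<delta> \<ge> \<Gamma> * (m / card V1) powr (- (1 - a / b))"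
proof -
  show 1: "card V1 > 0" "m \<le> card V1" using V1(2) L_ge(2) by linarith+
  have 2: "card V1 \<le> n" using card_mono[OF finite_V V1(1)] card_V by linarith
  show 3: "0 < m / card V1" using 1 m_pos by simp
  have inv: "u powr (- t) = inverse u powr t" if "u \<ge> 0" for u t :: real
    using that by (simp add: powr_minus inverse_powr)
  have "(m / card V1) powr (- (1 - a / b)) = (card V1 / m) powr (1 - a / b)"
    using inv[of "m / card V1" "1 - a / b"] by simp
  also have "\<dots> \<le> (n / m) powr (1 - a / b)"
    using 1 2 m_pos a_le_b b_ge_2 by (intro powr_mono2 divide_right_mono) auto
  finally have "\<Gamma> * (m / card V1) powr (- (1 - a / b)) \<le> \<Gamma> * (n / m) powr (1 - a / b)"
    by (rule mult_left_mono[OF _ \<Gamma>_ge(4)])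
  then show "\<delta> \<ge> \<Gamma> * (m / card V1) powr (- (1 - a / b))" using \<delta> by linarith
qed

lemma card_fwd':
  assumes "saturated U" "card U < L" "B \<subseteq> V1" "k \<le> b" "\<And>v. v \<in> B \<Longrightarrow> reach U k Z v (W v)"
  shows "real (card (fwd V1 B W)) \<ge> card B * (\<delta> / 2)"
proof (rule card_fwd[OF assms(1,2) V1(1) assms(3,4)])
  have "2 * real b ^ 2 + 2 * real b \<le> \<delta>" using \<Gamma>_ge(1,3) b_powers by linarith
  then show "\<delta> \<ge> 2 * b * (b + 1)" by (simp add: power2_eq_square algebra_simps)
qed (use assms(5) deg in auto)

lemma stage_spread:
  assumes "stage V1 k Z" "k < b" "Z + a > b" "Z \<le> b"
  shows "stage V1 (Suc k) (Z + a - b)"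
proof -
  obtain U B W where *: "saturated U" "surplus U \<ge> - int (b * k * m)" "card U < L" "B \<subseteq> V1"
    "\<forall>v\<in>B. reach U k Z v (W v)" "real (card B) \<ge> card V1 * (m / card V1) powr (Z / b)"
    using assms(1) less_imp_le[OF assms(2)] by (rule stageE)
  obtain B' where B': "B' \<subseteq> V1" "\<forall>w\<in>B'. \<exists>W. reach U (Suc k) (Z + a - b) w W"
    "card (fwd V1 B W) \<le> b * (1 + b * (b + 1)) * card B'"
    by (rule spread_step[OF *(1,3) less_imp_le[OF assms(2)] V1(1) *(4) assms(3,4) *(5)[rule_format]])
  show ?thesis
  proof (rule stageI[OF *(1) _ B'(1) B'(2)[rule_format]])
    have "b * k * m \<le> b * Suc k * m" by (intro mult_le_mono) auto
    then show "- int (b * Suc k * m) \<le> surplus U" using *(2) by linarith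
    have "real (card (fwd V1 B W)) \<ge> card B * (\<delta> / 2)"
      by (rule card_fwd'[OF *(1,3,4) less_imp_le[OF assms(2)] *(5)[rule_format]])
    then have "real (card B') \<ge> card V1 * (m / card V1) powr (Z / b - (1 - a / b))"
      by (intro spread_bound[OF V1_facts(3) _ V1_facts(4) *(6) _ B'(3)]) auto
    also have "real Z / b - (1 - a / b) = real (Z + a - b) / b"
      using assms(3) b_powers by (simp add: of_nat_diff field_simps)
    finally show "real (card B') \<ge> card V1 * (m / card V1) powr (real (Z + a - b) / b)" .
  qed
qed

lemma stage_root:
  assumes "stage V1 k Z" "k < b" "Z + a \<le> b"
  shows "stage V1 (Suc k) (Z + a)"
proof -
  obtain U B W where *: "saturated U" "surplus U \<ge> - int (b * k * m)" "card U < L" "B \<subseteq> V1"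
    "\<forall>v\<in>B. reach U k Z v (W v)" "real (card B) \<ge> card V1 * (m / card V1) powr (Z / b)"
    using assms(1) less_imp_le[OF assms(2)] by (rule stageE)
  obtain B' U' where B': "saturated U'" "surplus U' \<ge> - int (b * Suc k * m)" "B' \<subseteq> V1"
    "\<forall>w\<in>B'. \<exists>W. reach U' (Suc k) (Z + a) w W"
    "m * card (fwd V1 B W) \<le> card V1 * (2 * card (inside U') + b * card B')"
    by (rule root_step[OF *(1,3,2) assms(2) V1(1) *(4) V1_facts(2) assms(3) *(5)[rule_format]])
  have "b * Suc k * m \<le> b * b * m" using assms(2) by (intro mult_le_mono) auto
  then have "card U' < L" using B'(2) by (intro saturated_card_less[OF B'(1)]) linarith
  then have cI: "card (inside U') \<le> 2 * real L / \<theta>" by (rule card_inside_saturated[OF B'(1)])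
  show ?thesis
  proof (rule stageI[OF B'(1-3) B'(4)[rule_format]])
    have "real (Z + a) \<le> real b" using assms(3) by (simp only: of_nat_le_iff)
    then have t: "real Z / b + a / b \<le> 1" using b_powers(1) by (simp add: field_simps)
    have Q: "real (card (fwd V1 B W)) \<ge> card B * (\<delta> / 2)"
      by (rule card_fwd'[OF *(1,3,4) less_imp_le[OF assms(2)] *(5)[rule_format]])
    have "real (card B') \<ge> card V1 * (m / card V1) powr (Z / b + a / b)"
      by (rule root_bound[OF V1_facts(1,2) refl V1_facts(4) t *(6) Q cI B'(5)])
    also have "real Z / b + a / b = real (Z + a) / b" by (simp add: add_divide_distrib)
    finally show "real (card B') \<ge> card V1 * (m / card V1) powr (real (Z + a) / b)" .
  qed
qed

text \<open>After \<open>k\<close> steps the level is congruent to \<open>k * a\<close> modulo \<open>b\<close> and lies in \<open>{1..b}\<close>, so that it is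
  \<open>b\<close> after \<open>b\<close> steps.\<close>

lemma stage_level:
  assumes "stage V1 0 0" "k \<le> b"
  shows "\<exists>Z\<le>b. (k > 0 \<longrightarrow> Z > 0) \<and> Z mod b = (k * a) mod b \<and> stage V1 k Z"
  using assms(2)
proof (induction k)
  case 0
  then show ?case using assms(1) by (intro exI[of _ 0]) simp
next
  case (Suc k)
  then obtain Z where Z: "Z \<le> b" "Z mod b = (k * a) mod b" "stage V1 k Z" by auto
  have "(Z + a) mod b = (k * a + a) mod b" by (metis Z(2) mod_add_left_eq)
  then have m: "(Z + a) mod b = (Suc k * a) mod b" by (simp add: add.commute)
  show ?case
  proof (cases "Z + a \<le> b")
    case True
    then show ?thesis
      using stage_root[OF Z(3)] Suc.prems m a_pos by (intro exI[of _ "Z + a"]) auto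
  next
    case False
    then have "(Z + a - b) mod b = (Suc k * a) mod b" using m by (metis le_mod_geq nat_le_linear)
    then show ?thesis
      using stage_spread[OF Z(3)] Suc.prems Z(1) a_le_b False by (intro exI[of _ "Z + a - b"]) auto
  qed
qed

end

lemma inconsistent: False
proof -
  obtain U0 V1 where U0: "saturated U0" "surplus U0 \<ge> 0" "V1 \<subseteq> V - U0" and V1: "L < card V1"
    and deg: "\<forall>v\<in>V1. \<delta> \<le> card {e \<in> inside V1. v \<in> ends e}"
    by (rule ex_core)
  have V1V: "V1 \<subseteq> V" "V1 \<noteq> {}" using U0(3) V1 by auto
  obtain Z where Z: "Z \<le> b" "b > 0 \<longrightarrow> Z > 0" "Z mod b = b * a mod b" "stage V1 b Z"
    using stage_level[OF V1V(1) V1 deg[rule_format] stage_0[OF U0 V1V(2)] order_refl] by blast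
  have "b dvd Z" "Z > 0" using Z(2,3) b_ge_2 by (auto simp: mod_eq_0_iff_dvd)
  then have "Z = b" using Z(1) dvd_imp_le le_antisym by blast
  then show False using not_stage_b[OF order_refl V1V(2,1)] Z(4) by blast
qed

end

end

theorem dense_submultigraph:
  fixes a b R m n :: nat and \<theta> :: real
  assumes "multigraph V E ends" and "1 \<le> a" "a \<le> b" "2 \<le> b" "1 \<le> m" "0 < \<theta>"
    and "real a + 1 \<le> \<theta> * b" "\<theta> * b \<le> 2 * a"
    and "card V \<le> n" "b * (R + 2 * b) * m \<le> n"
    and "card E \<ge> 2 * n * (((10 + 8 * (real R + 2) / \<theta>) * b ^ 3) * (n / m) powr (1 - a / b))"
  shows "\<exists>U\<subseteq>V. card U \<le> 2 * (b * (R + 2 * b) * m) \<and>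
    \<theta> * card {e \<in> E. ends e \<subseteq> U} \<ge> card U + real (R * m)"
proof (rule ccontr)
  assume neg: "\<not> ?thesis"
  interpret multigraph V E ends by fact
  interpret saturation V E ends a b "2 * (b * (R + 2 * b) * m)"
    using assms by unfold_locales
  interpret sparse_multigraph V E ends a b R m \<theta>
    using assms neg by unfold_locales (auto simp: inside_def not_le)
  show False using inconsistent[OF assms(9,10) refl order_refl assms(11)] .
qed

subsection \<open>From multigraphs to hypergraphs\<close>

text \<open>One application of \<open>heavy_fibres\<close> per position keeps at least a proportion
  \<open>m / card V\<close> of the remaining edges; the chosen sets are united, so earlier positions
  stay inside \<open>S\<close>.\<close>

lemma sample_positions:
  assumes "finite V" "finite E" "m \<le> card V" "finite I"
    and "\<And>i e. i \<in> I \<Longrightarrow> e \<in> E \<Longrightarrow> f i e \<in> V"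
  shows "\<exists>S\<subseteq>V. card S \<le> m * card I \<and>
    m ^ card I * card E \<le> card V ^ card I * card {e \<in> E. \<forall>i\<in>I. f i e \<in> S}"
  using assms(4,5)
proof (induction I)
  case empty
  then show ?case by (intro exI[of _ "{}"]) auto
next
  case (insert i I)
  obtain S where S: "S \<subseteq> V" "card S \<le> m * card I"
    "m ^ card I * card E \<le> card V ^ card I * card {e \<in> E. \<forall>i\<in>I. f i e \<in> S}"
    using insert.IH insert.prems by auto
  define E' where "E' = {e \<in> E. \<forall>i\<in>I. f i e \<in> S}"
  obtain A where A: "A \<subseteq> V" "card A = m" "m * card E' \<le> card V * card {e \<in> E'. f i e \<in> A}"
    using insert.prems assms(1-3) by (elim heavy_fibres[of V m E' "f i", rotated 4]) (auto simp: E'_def)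
  have "{e \<in> E'. f i e \<in> A} \<subseteq> {e \<in> E. \<forall>j\<in>insert i I. f j e \<in> S \<union> A}" by (auto simp: E'_def)
  then have le: "card {e \<in> E'. f i e \<in> A} \<le> card {e \<in> E. \<forall>j\<in>insert i I. f j e \<in> S \<union> A}"
    using assms(2) by (intro card_mono) auto
  have "m ^ card (insert i I) * card E = m * (m ^ card I * card E)" using insert.hyps by simp
  also have "\<dots> \<le> m * (card V ^ card I * card E')" using S(3) unfolding E'_def by (rule mult_le_mono2)
  also have "\<dots> = card V ^ card I * (m * card E')" by simp
  also have "\<dots> \<le> card V ^ card I * (card V * card {e \<in> E. \<forall>j\<in>insert i I. f j e \<in> S \<union> A})"
    using A(3) le by (meson mult_le_mono2 order_trans)
  also have "\<dots> = card V ^ card (insert i I) * card {e \<in> E. \<forall>j\<in>insert i I. f j e \<in> S \<union> A}"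
    using insert.hyps by simp
  finally show ?case
    using S A card_Un_le[of S A] insert.hyps by (intro exI[of _ "S \<union> A"]) auto
qed

text \<open>The debt factor \<open>R\<close> becomes \<open>r\<close>, as the sampled set has at
  most \<open>(r - q - 2) * m\<close> vertices. The density condition has one factor
  \<open>m / n\<close> for each sampled position.\<close>

lemma dense_edge_set:
  fixes H :: "'a hypergraph" and a b m q r :: nat and \<theta> :: real
  defines "n \<equiv> card (verts H)" and "L \<equiv> b * (r + 2 * b) * m"
  assumes H: "r_graph r H" and q: "q + 2 \<le> r" and "2 \<le> a" "a \<le> b" "1 \<le> m" "0 < \<theta>"
    and \<theta>: "real a + 1 \<le> \<theta> * b" "\<theta> * b \<le> 2 * a" and L: "L \<le> n"
    and E: "2 * n * (((10 + 8 * (real r + 2) / \<theta>) * b ^ 3) * (n / m) powr (1 - a / b)) \<le>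
      card (edges H) * (m / n) ^ (r - q - 2)"
  shows "\<exists>F\<subseteq>edges H. F \<noteq> {} \<and> card (\<Union>F) \<le> (q + \<theta>) * card F \<and>
    card F \<le> (2 * real L + real (r * m)) / \<theta> + 1"
proof -
  have b: "2 \<le> b" using assms by simp
  have "1 * 1 * m \<le> L" unfolding L_def using b by (intro mult_le_mono) auto
  then have mn: "m \<le> n" using L by simp
  have n: "n > 0" using mn \<open>1 \<le> m\<close> by simp
  have fV: "finite (verts H)" and ns: "edges H \<subseteq> nsets (verts H) r" using H by (auto simp: r_graph_def)
  have fE: "finite (edges H)" using ns fV by (metis finite_subset finite_imp_finite_nsets)
  have edge: "e \<subseteq> verts H" "finite e" "card e = r" if "e \<in> edges H" for e
    using ns that by (auto simp: nsets_def)
  have "\<exists>f. bij_betw f {0..<r} e" if "e \<in> edges H" for e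
    using ex_bij_betw_nat_finite[of e] edge[OF that] by auto
  then obtain pos where pos: "\<And>e. e \<in> edges H \<Longrightarrow> bij_betw (pos e) {0..<r} e" by metis
  have pos_in: "pos e i \<in> e" if "e \<in> edges H" "i < r" for e i
    using pos[OF that(1)] that(2) by (auto simp: bij_betw_def)
  \<comment> \<open>Positions \<open>0\<close> and \<open>1\<close> of an edge give the multigraph, positions in \<open>I\<close> are restricted to few vertices
    \<open>S\<close>, and the \<open>q\<close> remaining ones are paid for edge by edge.\<close>
  define I where "I = {q + 2..<r}"
  have cI: "card I = r - q - 2" by (simp add: I_def)
  obtain S where S: "S \<subseteq> verts H" "card S \<le> m * card I"
    "m ^ card I * card (edges H) \<le> n ^ card I * card {e \<in> edges H. \<forall>i\<in>I. pos e i \<in> S}"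
    using sample_positions[of "verts H" "edges H" m I "\<lambda>i e. pos e i"] fV fE mn pos_in edge
    unfolding n_def I_def by fastforce
  define E' where "E' = {e \<in> edges H. \<forall>i\<in>I. pos e i \<in> S}"
  define ends where "ends e = {pos e 0, pos e 1}" for e
  have mg: "multigraph (verts H) E' ends"
  proof
    fix e assume "e \<in> E'"
    then have e: "e \<in> edges H" by (simp add: E'_def)
    show "ends e \<subseteq> verts H" using pos_in[OF e] edge(1)[OF e] q by (auto simp: ends_def)
    have "inj_on (pos e) {0..<r}" using pos[OF e] by (rule bij_betw_imp_inj_on)
    then have "pos e 0 \<noteq> pos e 1" using q inj_onD[of "pos e" "{0..<r}" 0 1] by auto
    then show "card (ends e) = 2" by (simp add: ends_def)
  qed (use fV fE in \<open>auto simp: E'_def\<close>)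
  have "real (m ^ card I * card (edges H)) \<le> real (n ^ card I * card E')"
    using S(3) unfolding E'_def by (simp only: of_nat_le_iff)
  then have "card (edges H) * (m / n) ^ card I \<le> card E'"
    using n by (simp add: power_divide field_simps)
  then have "card E' \<ge> 2 * n * (((10 + 8 * (real r + 2) / \<theta>) * b ^ 3) * (n / m) powr (1 - a / b))"
    using E unfolding cI by linarith
  then obtain U where U: "U \<subseteq> verts H" "card U \<le> 2 * L"
    "\<theta> * card {e \<in> E'. ends e \<subseteq> U} \<ge> card U + real (r * m)"
    using dense_submultigraph[OF mg, of a b m \<theta> n r] assms b unfolding L_def n_def by auto
  \<comment> \<open>The least number of edges for which \<theta> per edge pays for \<open>U\<close>
    and \<open>r * m\<close> further vertices. Taking only \<open>N\<close> edges also bounds the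
    vertices outside \<open>U\<close> and \<open>S\<close>, of which each edge brings at most
    \<open>q\<close>.\<close>
  define N where "N = nat \<lceil>(card U + real (r * m)) / \<theta>\<rceil>"
  have pos0: "(card U + real (r * m)) / \<theta> > 0"
    using \<open>1 \<le> m\<close> q \<open>0 < \<theta>\<close> by (intro divide_pos_pos add_nonneg_pos) auto
  have N: "(card U + real (r * m)) / \<theta> \<le> N" "N \<le> (card U + real (r * m)) / \<theta> + 1" "N > 0"
    using pos0 unfolding N_def by linarith+
  have "(card U + real (r * m)) / \<theta> \<le> card {e \<in> E'. ends e \<subseteq> U}"
    using U(3) \<open>0 < \<theta>\<close> by (simp add: field_simps)
  then have "N \<le> card {e \<in> E'. ends e \<subseteq> U}" unfolding N_def by linarith
  then obtain F where F: "F \<subseteq> {e \<in> E'. ends e \<subseteq> U}" "card F = N" "finite F"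
    by (rule obtain_subset_with_card_n)
  have FH: "F \<subseteq> edges H" using F(1) by (auto simp: E'_def)
  have "\<Union>F \<subseteq> U \<union> S \<union> (\<Union>e\<in>F. pos e ` {2..<q + 2})"
  proof
    fix v assume "v \<in> \<Union>F"
    then obtain e where e: "e \<in> F" "v \<in> e" by auto
    then have "pos e ` {0..<r} = e" using FH by (intro bij_betw_imp_surj_on[OF pos]) auto
    then obtain i where i: "i < r" "v = pos e i" using e(2) by force
    consider "i = 0 \<or> i = 1" | "i \<in> {2..<q + 2}" | "i \<in> I" using i by (fastforce simp: I_def)
    then show "v \<in> U \<union> S \<union> (\<Union>e\<in>F. pos e ` {2..<q + 2})"
    proof cases
      case 2
      then have "v \<in> pos e ` {2..<q + 2}" using i(2) by blast
      then show ?thesis using e(1) by blast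
    qed (use e i F(1) in \<open>auto simp: E'_def ends_def\<close>)
  qed
  then have "card (\<Union>F) \<le> card (U \<union> S \<union> (\<Union>e\<in>F. pos e ` {2..<q + 2}))"
    using F(3) U(1) S(1) fV by (intro card_mono) (auto intro: finite_subset)
  also have "\<dots> \<le> card U + card S + card (\<Union>e\<in>F. pos e ` {2..<q + 2})"
    by (meson add_mono card_Un_le le_refl order_trans)
  also have "card (\<Union>e\<in>F. pos e ` {2..<q + 2}) \<le> (\<Sum>e\<in>F. q)"
    by (rule order_trans[OF card_UN_le[OF F(3)]], rule sum_mono)
      (use card_image_le[of "{2..<q + 2}"] in auto)
  also have "card S \<le> r * m" using S(2) unfolding cI by (metis diff_diff_left diff_le_self mult.commute mult_le_mono1 order_trans)
  finally have "card (\<Union>F) \<le> card U + r * m + N * q" using F(2) by simp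
  then have "real (card (\<Union>F)) \<le> real (card U + r * m + N * q)" by (simp only: of_nat_le_iff)
  also have "\<dots> = card U + real (r * m) + q * real N" by simp
  also have "\<dots> \<le> (q + \<theta>) * N" using N(1) \<open>0 < \<theta>\<close> by (simp add: field_simps)
  finally have 1: "card (\<Union>F) \<le> (q + \<theta>) * card F" using F(2) by simp
  have "real (card U) \<le> 2 * real L" using U(2) by (metis of_nat_le_iff of_nat_mult of_nat_numeral)
  then have "(card U + real (r * m)) / \<theta> \<le> (2 * real L + real (r * m)) / \<theta>"
    using \<open>0 < \<theta>\<close> by (intro divide_right_mono) auto
  then have "card F \<le> (2 * real L + real (r * m)) / \<theta> + 1" using N(2) F(2) by simp
  moreover have "F \<noteq> {}" using F(2) N(3) by auto
  ultimately show ?thesis using FH 1 by blast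
qed

text \<open>Here \<open>p\<close> stands for \<open>m / n\<close>. At the ideal exponent \<kappa>
  the lower bound on \<open>p\<close> makes \<open>d * p powr \<kappa>\<close> at least
  \<open>l ^ 4\<close>, since \<open>\<alpha> * \<kappa> = 1\<close>. The error \<open>2 / b\<close>
  costs only a constant factor because \<open>b\<close> is at least \<open>ln d\<close>.\<close>

lemma degree_bound:
  fixes d l p \<alpha> \<kappa> t K b :: real
  assumes "d > 1" "l = ln d" "1 \<le> l" "l \<le> b" "b \<le> 2 * l" "\<alpha> * \<kappa> = 1" "\<alpha> > 0" "\<kappa> > 0" "0 < p" "p \<le> 1"
    and p: "d powr (- \<alpha>) * l powr (4 * \<alpha>) \<le> p" and t: "t \<le> \<kappa> + 2 / b"
    and K: "K \<ge> 0" "16 * K * exp (2 * \<alpha>) \<le> l"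
  shows "2 * K * b ^ 3 \<le> d * p powr t"
proof -
  have d: "d = exp l" using assms by simp
  have b: "b > 0" using assms by simp
  have "\<alpha> * (2 / b) * l \<le> 2 * \<alpha>" using assms b by (simp add: field_simps)
  then have "exp (- (2 * \<alpha>)) \<le> exp (- (\<alpha> * (2 / b) * l))" by simp
  moreover have "(1::real) \<le> l powr (4 * \<alpha> * (2 / b))" using assms b by (intro ge_one_powr_ge_zero) auto
  ultimately have "exp (- (2 * \<alpha>)) * 1 \<le> exp (- (\<alpha> * (2 / b) * l)) * l powr (4 * \<alpha> * (2 / b))"
    by (intro mult_mono) auto
  then have "l ^ 4 * exp (- (2 * \<alpha>)) \<le> l ^ 4 * (exp (- (\<alpha> * (2 / b) * l)) * l powr (4 * \<alpha> * (2 / b)))"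
    by (intro mult_left_mono) auto
  also have "\<dots> = d * (d powr (- \<alpha>) * l powr (4 * \<alpha>)) powr (\<kappa> + 2 / b)"
  proof -
    have "l powr 4 = l ^ 4" using assms by (simp add: powr_numeral)
    moreover have "4 * \<alpha> * (\<kappa> + 2 / b) = 4 + 4 * \<alpha> * (2 / b)" using assms(6) by (simp add: algebra_simps)
    moreover have "- \<alpha> * (\<kappa> + 2 / b) = - 1 - \<alpha> * (2 / b)" using assms(6) by (simp add: algebra_simps)
    moreover have "(d powr (- \<alpha>) * l powr (4 * \<alpha>)) powr (\<kappa> + 2 / b) =
        d powr (- \<alpha> * (\<kappa> + 2 / b)) * l powr (4 * \<alpha> * (\<kappa> + 2 / b))"
      by (simp only: powr_mult powr_powr powr_ge_zero)
    ultimately have "(d powr (- \<alpha>) * l powr (4 * \<alpha>)) powr (\<kappa> + 2 / b) =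
        d powr (- 1 - \<alpha> * (2 / b)) * (l ^ 4 * l powr (4 * \<alpha> * (2 / b)))"
      by (simp only: powr_add)
    moreover have "d * d powr (- 1 - \<alpha> * (2 / b)) = exp (- (\<alpha> * (2 / b) * l))"
    proof -
      have "d powr (- 1 - \<alpha> * (2 / b)) = exp ((- 1 - \<alpha> * (2 / b)) * ln d)"
        using assms(1) by (simp add: powr_def)
      also have "d * \<dots> = exp (l + (- 1 - \<alpha> * (2 / b)) * ln d)" by (simp only: d exp_add ln_exp)
      also have "l + (- 1 - \<alpha> * (2 / b)) * ln d = - (\<alpha> * (2 / b) * l)"
        by (simp add: assms(2) algebra_simps)
      finally show ?thesis .
    qed
    ultimately have "d * (d powr (- \<alpha>) * l powr (4 * \<alpha>)) powr (\<kappa> + 2 / b) =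
        exp (- (\<alpha> * (2 / b) * l)) * (l ^ 4 * l powr (4 * \<alpha> * (2 / b)))"
      by (simp only: mult.assoc[symmetric])
    then show ?thesis by simp
  qed
  also have "\<dots> \<le> d * p powr (\<kappa> + 2 / b)"
    using assms b by (intro mult_left_mono powr_mono2) auto
  also have "\<dots> \<le> d * p powr t" using assms by (intro mult_left_mono powr_mono') auto
  finally have 1: "l ^ 4 * exp (- (2 * \<alpha>)) \<le> d * p powr t" .
  \<comment> \<open>The fourth power of \<open>l\<close> beats the cube of \<open>b\<close>, and the
    spare factor \<open>l\<close> absorbs the constants.\<close>
  have "2 * K * b ^ 3 \<le> 2 * K * (2 * l) ^ 3" using assms b by (intro mult_left_mono power_mono) auto
  also have "\<dots> = (16 * K * exp (2 * \<alpha>)) * (l ^ 3 * exp (- (2 * \<alpha>)))"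
    by (simp add: exp_minus power_mult_distrib)
  also have "\<dots> \<le> l * (l ^ 3 * exp (- (2 * \<alpha>)))" using K assms(3) by (intro mult_right_mono) auto
  also have "\<dots> = l ^ 4 * exp (- (2 * \<alpha>))" by (simp add: eval_nat_numeral)
  finally show ?thesis using 1 by linarith
qed

section \<open>Choice of the parameters for large \<open>d\<close>\<close>

lemma eventually_large:
  fixes \<alpha> c1 c2 :: real
  assumes "\<alpha> > 0"
  shows "\<exists>d0. \<forall>d\<ge>d0. d > 1 \<and> c1 \<le> ln d \<and> c2 * ln d powr (2 + 4 * \<alpha>) \<le> d powr \<alpha>"
proof -
  have "eventually (\<lambda>d::real. d > 1 \<and> c1 \<le> ln d \<and> c2 * ln d powr (2 + 4 * \<alpha>) \<le> d powr \<alpha>) at_top"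
    using assms by (intro eventually_conj eventually_gt_at_top) real_asymp+
  then show ?thesis by (simp add: eventually_at_top_linorder)
qed

theorem theorem2:
  fixes r :: nat and s :: real
  assumes "r \<ge> 3" and "s > real r / (real r - 1)"
  shows "\<exists>C d\<^sub>0 :: real. \<forall>d :: real. d \<ge> d\<^sub>0 \<longrightarrow>
    (\<forall>(n :: nat) (H :: 'a hypergraph).
       r_graph r H \<and> verts H \<noteq> {} \<and> card (verts H) = n \<and>
       avg_degree r H \<ge> d \<and> d \<le> real n powr (1 / alpha r s) \<longrightarrow>
       (\<exists>H' :: 'a hypergraph.
          r_graph r H' \<and> subhypergraph H' H \<and> verts H' \<noteq> {} \<and> avg_degree r H' \<ge> s \<and>
          real (card (verts H')) \<le> real n * d powr (- alpha r s) * (ln d) powr C))"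
proof -
  define \<kappa> where "\<kappa> = real r - 1 - r / s"
  define \<alpha> where "\<alpha> = alpha r s"
  have s: "s > 0" using assms by (auto intro: le_less_trans[rotated])
  have "r / s < real r - 1" using assms s by (simp add: field_simps)
  then have \<kappa>: "\<kappa> > 0" by (simp add: \<kappa>_def)
  have "(real r - 1) * s - r = s * \<kappa>" using s by (simp add: \<kappa>_def field_simps)
  then have \<alpha>: "\<alpha> * \<kappa> = 1" "\<alpha> > 0" using s \<kappa> by (simp_all add: \<alpha>_def alpha_def)
  \<comment> \<open>One less than the ceiling instead of the floor, so that \<theta> is 1 and not 0
    when \<open>r / s\<close> is an integer.\<close>
  define q where "q = nat (\<lceil>r / s\<rceil> - 1)"
  define \<theta> where "\<theta> = r / s - q"
  have rs: "r / s > 0" using assms s by simp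
  have q: "real q < r / s" "r / s \<le> real q + 1" "q + 2 \<le> r"
    using rs \<open>r / s < real r - 1\<close> unfolding q_def by linarith+
  have \<theta>: "0 < \<theta>" "\<theta> \<le> 1" "r / s = q + \<theta>" using q by (auto simp: \<theta>_def)
  define h where "h = r - q - 2"
  \<comment> \<open>The exponent splits into \<open>h\<close> for the sampled positions and
    \<open>1 - \<theta>\<close> for the multigraph.\<close>
  have h: "\<kappa> = real h + 1 - \<theta>" using q(3) \<theta>(3) by (simp add: \<kappa>_def h_def of_nat_diff)
  define c0 where "c0 = 10 + 8 * (real r + 2) / \<theta>"
  define K where "K = real r * c0"
  have K: "K \<ge> 0" using \<theta> by (simp add: K_def c0_def)
  define c1 where "c1 = 4 / \<theta> + 16 * K * exp (2 * \<alpha>) + r / s * (4 / \<theta>) * (8 * (real r + 2)) + 2"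
  obtain d0 where d0: "\<And>d. d \<ge> d0 \<Longrightarrow> d > 1 \<and> c1 \<le> ln d \<and>
      8 * (real r + 2) * ln d powr (2 + 4 * \<alpha>) \<le> d powr \<alpha>"
    using eventually_large[OF \<alpha>(2)] by metis
  \<comment> \<open>In the exponent \<open>3 + 4 * \<alpha>\<close>, 2 comes from the factor of
    order \<open>b ^ 2\<close> in \<open>L\<close>, \<open>4 * \<alpha>\<close> from
    \<open>m\<close>, and 1 absorbs the constants.\<close>
  have "\<exists>H'. r_graph r H' \<and> subhypergraph H' H \<and> verts H' \<noteq> {} \<and> avg_degree r H' \<ge> s \<and>
      real (card (verts H')) \<le> real n * d powr (- \<alpha>) * (ln d) powr (3 + 4 * \<alpha>)"
    if d: "d \<ge> d0" and H: "r_graph r H" "verts H \<noteq> {}" "card (verts H) = n" "avg_degree r H \<ge> d"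
      and dn: "d \<le> real n powr (1 / \<alpha>)" for d :: real and n :: nat and H :: "'a hypergraph"
  proof -
    define l where "l = ln d"
    have d1: "d > 1" using d0[OF d] by simp
    have pos_terms: "4 / \<theta> > 0" "16 * K * exp (2 * \<alpha>) \<ge> 0" "r / s * (4 / \<theta>) * (8 * (real r + 2)) \<ge> 0"
      using K \<theta> s by simp_all
    have l: "2 \<le> l" "4 / \<theta> \<le> l" "16 * K * exp (2 * \<alpha>) \<le> l" "r / s * (4 / \<theta>) * (8 * (real r + 2)) \<le> l"
      using d0[OF d] pos_terms unfolding c1_def l_def by linarith+
    have big: "8 * (real r + 2) * l powr (2 + 4 * \<alpha>) \<le> d powr \<alpha>" using d0[OF d] by (simp add: l_def)
    define b where "b = nat \<lceil>l\<rceil>"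
    have b: "l \<le> b" "b \<le> 2 * l" "b > 0" using l unfolding b_def by linarith+
    \<comment> \<open>This rounding puts \<open>\<theta> * b\<close> between \<open>a + 1\<close>
      and \<open>a + 2\<close>: the spare 1 needed for sparsity, at an error of at most
      \<open>2 / b\<close> in the exponent.\<close>
    define a where "a = nat (\<lceil>\<theta> * b\<rceil> - 2)"
    have "4 \<le> \<theta> * l" using l(2) \<theta> by (simp add: field_simps)
    also have "\<dots> \<le> \<theta> * b" using b \<theta> by (intro mult_left_mono) auto
    finally have \<theta>b: "4 \<le> \<theta> * b" .
    then have a: "real a + 1 \<le> \<theta> * b" "\<theta> * b \<le> a + 2" "2 \<le> a" unfolding a_def by linarith+
    have "\<theta> * b \<le> b" using \<theta> b by (simp add: mult_left_le_one_le)
    then have ab: "a \<le> b" using a by linarith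
    have n: "n > 0" using H by (auto simp: r_graph_def card_gt_0_iff)
    \<comment> \<open>The power of \<open>l\<close> beyond the ideal size
      \<open>n * d powr (- \<alpha>)\<close> is what yields \<open>l ^ 4\<close> in
      \<open>degree_bound\<close>.\<close>
    define X where "X = n * d powr (- \<alpha>) * l powr (4 * \<alpha>)"
    have "d powr \<alpha> \<le> (real n powr (1 / \<alpha>)) powr \<alpha>" using dn d1 \<alpha> by (intro powr_mono2) auto
    also have "\<dots> = n" using \<alpha> n by (simp add: powr_powr)
    finally have dn': "d powr \<alpha> \<le> n" .
    then have "1 \<le> n * d powr (- \<alpha>)" using d1 by (simp add: powr_minus field_simps)
    moreover have "1 \<le> l powr (4 * \<alpha>)" using l \<alpha> by (intro ge_one_powr_ge_zero) auto
    ultimately have X1: "1 \<le> X" using mult_mono[of 1 "n * d powr (- \<alpha>)" 1 "l powr (4 * \<alpha>)"]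
      by (simp add: X_def)
    \<comment> \<open>Since \<open>X\<close> is at least 1, by the upper bound on \<open>d\<close>,
      rounding up at most doubles it.\<close>
    define m where "m = nat \<lceil>X\<rceil>"
    have m: "X \<le> m" "m \<le> 2 * X" "1 \<le> m" using X1 unfolding m_def by linarith+
    define L where "L = b * (r + 2 * b) * m"
    have b1: "real b \<ge> 1" using b l by linarith
    have "real L = (b * r + 2 * b * b) * real m" by (simp add: L_def algebra_simps)
    also have "\<dots> \<le> (b * b * r + 2 * b * b) * (2 * X)"
    proof (rule mult_mono)
      have "1 * real b * r \<le> real b * b * r" using b1 by (intro mult_right_mono) auto
      then show "real (b * r + 2 * b * b) \<le> real (b * b * r + 2 * b * b)" by simp
    qed (use m X1 in auto)
    also have "\<dots> = (real r + 2) * (real b * b) * (2 * X)" by (simp add: algebra_simps)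
    also have "\<dots> \<le> (real r + 2) * (2 * l * (2 * l)) * (2 * X)"
      using b X1 by (intro mult_mono mult_left_mono) auto
    also have "\<dots> = 8 * (real r + 2) * l powr (2 + 4 * \<alpha>) * (n * d powr (- \<alpha>))"
      using l by (simp add: X_def powr_add powr_numeral power2_eq_square algebra_simps)
    finally have L: "L \<le> 8 * (real r + 2) * l powr (2 + 4 * \<alpha>) * (n * d powr (- \<alpha>))" .
    also have "\<dots> \<le> d powr \<alpha> * (n * d powr (- \<alpha>))" using big by (intro mult_right_mono) auto
    also have "\<dots> = n" using d1 by (simp add: powr_minus field_simps)
    finally have Ln: "L \<le> n" by simp
    have "1 * 1 * m \<le> L" "1 * r * m \<le> L" unfolding L_def using b by (intro mult_le_mono; simp)+
    then have mL: "m \<le> L" "r * m \<le> L" by simp_all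
    have mn: "m \<le> n" using mL Ln by simp
    define p where "p = real m / n"
    have p: "0 < p" "p \<le> 1" using m mn n by (auto simp: p_def)
    have "X / n \<le> p" unfolding p_def using m by (intro divide_right_mono) auto
    then have p0: "d powr (- \<alpha>) * l powr (4 * \<alpha>) \<le> p" using n by (simp add: X_def)
    have t: "real h + 1 - a / b \<le> \<kappa> + 2 / b"
    proof -
      have "(\<theta> * b - 2) / b \<le> a / b" using a(2) by (intro divide_right_mono) auto
      then show ?thesis using b(3) by (simp add: h diff_divide_distrib)
    qed
    have "2 * K * b ^ 3 \<le> d * p powr (real h + 1 - a / b)"
      using degree_bound[OF d1 l_def _ b(1,2) \<alpha> \<kappa> p p0 t K l(3)] l by simp
    also have "p powr (real h + 1 - a / b) = p ^ h * p powr (1 - a / b)"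
    proof -
      have "p powr (h + (1 - a / b)) = p powr h * p powr (1 - a / b)" by (rule powr_add)
      then show ?thesis using p by (simp only: powr_realpow add_diff_eq)
    qed
    finally have deg: "2 * K * b ^ 3 \<le> d * p ^ h * p powr (1 - a / b)" by simp
    have "d \<le> r * real (card (edges H)) / n" using H by (simp add: avg_degree_def)
    then have dE: "d * n \<le> r * real (card (edges H))" using n by (simp add: field_simps)
    have inv: "(n / m) powr (1 - a / b) * p powr (1 - a / b) = 1"
      using m n by (simp add: p_def flip: powr_mult)
    have "2 * K * b ^ 3 * (n / m) powr (1 - a / b) \<le>
        d * p ^ h * p powr (1 - a / b) * (n / m) powr (1 - a / b)"
      using deg by (intro mult_right_mono) auto
    also have "\<dots> = d * p ^ h" using inv by (simp add: mult_ac)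
    finally have "2 * K * b ^ 3 * (n / m) powr (1 - a / b) * n \<le> d * p ^ h * n"
      by (intro mult_right_mono) auto
    also have "\<dots> = d * n * p ^ h" by simp
    also have "\<dots> \<le> r * real (card (edges H)) * p ^ h" using dE p by (intro mult_right_mono) auto
    finally have "r * (2 * real n * ((c0 * b ^ 3) * (n / m) powr (1 - a / b))) \<le>
        r * (card (edges H) * p ^ h)" by (simp add: K_def mult_ac)
    then have E: "2 * real n * ((c0 * b ^ 3) * (n / m) powr (1 - a / b)) \<le>
        card (edges H) * p ^ h" using assms(1) by (subst (asm) mult_le_cancel_left_pos) auto
    have "\<exists>F\<subseteq>edges H. F \<noteq> {} \<and> card (\<Union>F) \<le> (q + \<theta>) * card F \<and>
        card F \<le> (2 * real L + real (r * m)) / \<theta> + 1"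
      unfolding L_def
    proof (rule dense_edge_set[OF H(1) q(3) a(3) ab m(3) \<theta>(1) a(1)])
      show "\<theta> * b \<le> 2 * a" using a by linarith
      show "b * (r + 2 * b) * m \<le> card (verts H)" unfolding H(3) by (fact Ln[unfolded L_def])
    qed (unfold H(3), fact E[unfolded p_def h_def c0_def])
    then obtain F where F: "F \<subseteq> edges H" "F \<noteq> {}" "card (\<Union>F) \<le> (q + \<theta>) * card F"
      "card F \<le> (2 * real L + real (r * m)) / \<theta> + 1" by blast
    define H' where "H' = \<lparr>verts = \<Union>F, edges = F\<rparr>"
    have fV: "finite (verts H)" and ns: "edges H \<subseteq> nsets (verts H) r" using H(1) by (auto simp: r_graph_def)
    have sub: "\<Union>F \<subseteq> verts H" using F(1) ns by (auto simp: nsets_def)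
    have fU: "finite (\<Union>F)" using sub fV finite_subset by blast
    have "r_graph r H'" using F(1) ns fU by (auto simp: r_graph_def H'_def nsets_def)
    moreover have "subhypergraph H' H" using F(1) sub by (auto simp: subhypergraph_def H'_def)
    moreover obtain e where "e \<in> F" using F(2) by auto
    then have "e \<noteq> {}" using F(1) ns assms(1) by (auto simp: nsets_def)
    with \<open>e \<in> F\<close> have ne: "\<Union>F \<noteq> {}" by auto
    then have "verts H' \<noteq> {}" by (simp add: H'_def)
    moreover have "avg_degree r H' \<ge> s"
    proof -
      have "card (\<Union>F) > 0" using ne fU by (simp add: card_gt_0_iff)
      moreover have "card (\<Union>F) \<le> r / s * card F" using F(3) \<theta>(3) by simp
      ultimately show ?thesis using s by (simp add: avg_degree_def H'_def field_simps)
    qed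
    moreover have "card (verts H') \<le> real n * d powr (- \<alpha>) * l powr (3 + 4 * \<alpha>)"
    proof -
      have L1: "real L \<ge> 1" using mL(1) m(3) by (metis of_nat_1 of_nat_mono order_trans)
      have "(2 * real L + real (r * m)) / \<theta> \<le> 3 * real L / \<theta>"
        using mL(2) \<theta> by (intro divide_right_mono) (auto simp flip: of_nat_mult)
      moreover have "1 \<le> real L / \<theta>" using L1 \<theta> by simp
      ultimately have "card F \<le> 4 / \<theta> * L" using F(4) by simp
      then have "r / s * card F \<le> r / s * (4 / \<theta> * L)" using rs by (intro mult_left_mono) auto
      also have "\<dots> \<le> r / s * (4 / \<theta> * (8 * (real r + 2) * l powr (2 + 4 * \<alpha>) * (n * d powr (- \<alpha>))))"
        using L rs \<theta> by (intro mult_left_mono) auto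
      also have "\<dots> = r / s * (4 / \<theta>) * (8 * (real r + 2)) * (l powr (2 + 4 * \<alpha>) * (n * d powr (- \<alpha>)))"
        by (simp add: mult_ac)
      also have "\<dots> \<le> l * (l powr (2 + 4 * \<alpha>) * (n * d powr (- \<alpha>)))"
        using l(4) by (intro mult_right_mono) auto
      also have "\<dots> = real n * d powr (- \<alpha>) * l powr (1 + (2 + 4 * \<alpha>))"
        using l unfolding powr_add by simp
      finally show ?thesis using F(3) \<theta>(3) by (simp add: H'_def)
    qed
    ultimately show ?thesis unfolding l_def by blast
  qed
  then show ?thesis unfolding \<alpha>_def by blast
qed

end
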